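(* Let $(X,Y)$ be a two-dimensional random vector with $EX=0$ and $0<v^2:=\operatorname{var}(X)<\infty$ ($v>0$), and set $(Q,M)=(e^Y,e^X)$. Let $(Q_n,M_n)_{n\ge1}$ be i.i.d. copies of $(Q,M)$, and define $R_0=0$, $R_n=Q_n+M_nR_{n-1}$ for $n\ge1$ (equivalently, in distribution, $R_n\stackrel d=\sum_{k=1}^nQ_k\prod_{j=1}^{k-1}M_j$). (i) If $EY^2<\infty$, then as $n\to\infty$ $$R_n^{1/(v\sqrt n)}\xrightarrow{d} e^{|\mathcal N|},$$ where $|\mathcal N|$ is the absolute value of a standard normal random variable, i.e. $P(|\mathcal N|\le x)=\sqrt{2/\pi}\int_0^x e^{-t^2/2}\,dt$ for $x\ge0$. (ii) Let $h(t):=P(Y>t)$ and $\gamma_n:=\inf\{t: h(t)\le 1/n\}$, $n\ge1$. If $h$ is regularly varying at infinity with index $\alpha$ for some $-2<\alpha<0$, then as $n\to\infty$ $$R_n^{1/\gamma_n}\xrightarrow{d} e^{V_\alpha},$$ where $V_\alpha$ has the Fréchet distribution $P(V_\alpha\le x)=0$ for $x\le 0$ and $P(V_\alpha\le x)=\exp(-x^{\alpha})$ for $x>0$. (iii) Suppose $h$ (with $h$, $\gamma_n$, $V_\alpha$ as in (ii)) is regularly varying at infinity with index $-2$, i.e. $h(t)=t^{-2}\ell(t)$ with $\ell$ slowly varying at infinity. If $\lim_{t\to\infty}\ell(t)=\infty$, then $R_n^{1/\gamma_n}\xrightarrow{d} e^{V_{-2}}$; if $\lim_{t\to\infty}\ell(t)=0$,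 then $R_n^{1/(v\sqrt n)}\xrightarrow{d} e^{|\mathcal N|}$.
   Context: A function $h$ is regularly varying at infinity with index $\rho$ if $\lim_{t\to\infty}h(xt)/h(t)=x^\rho$ for every $x>0$; $\ell$ is slowly varying at infinity if $\lim_{t\to\infty}\ell(xt)/\ell(t)=1$ for every $x>0$. $\xrightarrow{d}$ denotes convergence in distribution. *)

theory Defs
  imports "HOL-Probability.Probability"
begin

definition regularly_varying :: "(real \<Rightarrow> real) \<Rightarrow> real \<Rightarrow> bool" where
  "regularly_varying h \<rho> \<longleftrightarrow> (\<forall>x>0. ((\<lambda>t. h (x * t) / h t) \<longlongrightarrow> x powr \<rho>) at_top)"

primrec perp_R :: "(nat \<Rightarrow> 'a \<Rightarrow> real) \<Rightarrow> (nat \<Rightarrow> 'a \<Rightarrow> real) \<Rightarrow> nat \<Rightarrow> 'a \<Rightarrow> real" where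
  "perp_R Xs Ys 0 \<omega> = 0"
| "perp_R Xs Ys (Suc n) \<omega> = exp (Ys (Suc n) \<omega>) + exp (Xs (Suc n) \<omega>) * perp_R Xs Ys n \<omega>"

definition abs_normal_cdf :: "real \<Rightarrow> real" where
  "abs_normal_cdf x = (if x < 0 then 0 else sqrt (2 / pi) * integral {0..x} (\<lambda>t. exp (- (t\<^sup>2) / 2)))"

definition frechet_cdf :: "real \<Rightarrow> real \<Rightarrow> real" where
  "frechet_cdf \<alpha> x = (if x \<le> 0 then 0 else exp (- (x powr \<alpha>)))"

text \<open>If V has CDF F, then exp V has CDF x \<mapsto> P(V \<le> ln x) for x > 0, and 0 for x \<le> 0.\<close>
definition exp_cdf :: "(real \<Rightarrow> real) \<Rightarrow> real \<Rightarrow> real" where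
  "exp_cdf F x = (if x \<le> 0 then 0 else F (ln x))"

definition conv_distr_to :: "'a measure \<Rightarrow> (nat \<Rightarrow> 'a \<Rightarrow> real) \<Rightarrow> (real \<Rightarrow> real) \<Rightarrow> bool" where
  "conv_distr_to M Z G \<longleftrightarrow> weak_conv (\<lambda>n. cdf (distr M borel (Z n))) G"

end

theory Submission
  imports Defs
begin

text \<open>
  Put \<open>D n k = X\<^sub>k\<^sub>+\<^sub>1 + \<dots> + X\<^sub>n\<close>. Then \<open>R n\<close> is the sum over \<open>k \<le> n\<close> of \<open>exp (Y\<^sub>k + D n k)\<close>, so
  \<open>ln (R n)\<close> is the maximum of \<open>Y\<^sub>k + D n k\<close> up to an error of \<open>ln n\<close>, which both scalings kill.

  If \<open>t\<^sup>2 P(Y > t) \<longrightarrow> 0\<close>, the largest \<open>Y\<^sub>k\<close> is negligible against \<open>\<surd>n\<close>, and the maximum of \<open>D n k\<close> is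
  governed by an approximate reflection principle: letting \<open>k\<close> decrease from \<open>n\<close> to the first time
  \<open>D n k\<close> exceeds a level, the remaining increment \<open>X\<^sub>1 + \<dots> + X\<^sub>k\<close> is independent of the past and
  is positive with probability close to 1/2 by the central limit theorem. Hence the maximum exceeds
  the level with about twice the probability that \<open>X\<^sub>1 + \<dots> + X\<^sub>n\<close> does. The lower bound takes
  \<open>Y\<^sub>k\<close> at the passage time, which is independent of it, so no control of the lower tail of \<open>Y\<close> is needed.

  If \<open>t\<^sup>2 P(Y > t) \<longrightarrow> \<infinity>\<close>, then \<open>\<gamma> n\<close> dominates \<open>\<surd>n\<close>, so the walk is negligible and the maximum of
  the \<open>Y\<^sub>k\<close> decides; regular variation gives \<open>n P(Y > z \<gamma> n) \<longrightarrow> z\<^sup>\<alpha>\<close>. An index \<open>\<alpha> > -2\<close> forces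
  \<open>t\<^sup>2 P(Y > t) \<longrightarrow> \<infinity>\<close> by doubling.
\<close>

subsection \<open>Real analysis\<close>

text \<open>The limit proofs below work with a slack \<open>d\<close>. This extracts one concrete
  \<open>d\<close> from a property holding near 0 on the right, with \<open>d < b\<close> keeping
  denominators or thresholds positive where that matters.\<close>

lemma eventually_at_right_0E:
  fixes P :: "real \<Rightarrow> bool"
  assumes "eventually P (at_right 0)" and "b > 0"
  obtains d where "0 < d" "d < b" "P d"
proof -
  have "\<forall>\<^sub>F d in at_right (0::real). 0 < d \<and> d < b"
    using assms(2) by (auto intro!: eventually_at_rightI[of 0 b])
  then have "\<forall>\<^sub>F d in at_right 0. (0 < d \<and> d < b) \<and> P d"
    using assms(1) by (rule eventually_conj)
  from eventually_happens'[OF _ this] that show ?thesis by auto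
qed

text \<open>Poisson approximation with a varying success probability. Both bounds on
  \<open>ln (1 - p n)\<close> come from \<open>ln x \<le> x - 1\<close>, taken at
  \<open>1 - p n\<close> and at its inverse; they merge in the limit because \<open>p n\<close>
  tends to 0.\<close>

lemma power_one_minus_tendsto_exp:
  fixes p :: "nat \<Rightarrow> real"
  assumes p: "\<And>n. 0 \<le> p n" and lim: "(\<lambda>n. real n * p n) \<longlonglongrightarrow> c"
  shows "(\<lambda>n. (1 - p n) ^ n) \<longlonglongrightarrow> exp (- c)"
proof -
  have p0: "p \<longlonglongrightarrow> 0"
  proof (rule Lim_transform_eventually)
    show "(\<lambda>n. (real n * p n) * inverse (real n)) \<longlonglongrightarrow> 0"
      using tendsto_mult[OF lim lim_inverse_n] by simp
    show "\<forall>\<^sub>F n in sequentially. (real n * p n) * inverse (real n) = p n"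
      using eventually_gt_at_top[of 0] by eventually_elim simp
  qed
  have small: "\<forall>\<^sub>F n in sequentially. p n < 1"
    using order_tendstoD(2)[OF p0] by simp
  have "(\<lambda>n. real n * ln (1 - p n)) \<longlonglongrightarrow> - c"
  proof (rule tendsto_sandwich)
    show "\<forall>\<^sub>F n in sequentially. real n * ln (1 - p n) \<le> - (real n * p n)"
      using small
    proof eventually_elim
      case (elim n)
      have "real n * ln (1 - p n) \<le> real n * (- p n)"
        using ln_le_minus_one[of "1 - p n"] elim by (intro mult_left_mono) auto
      then show ?case by simp
    qed
    show "\<forall>\<^sub>F n in sequentially. - ((real n * p n) / (1 - p n)) \<le> real n * ln (1 - p n)"
      using small
    proof eventually_elim
      case (elim n)
      have "- ln (1 - p n) \<le> inverse (1 - p n) - 1"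
        using ln_le_minus_one[of "inverse (1 - p n)"] elim by (simp add: ln_inverse)
      also have "\<dots> = p n / (1 - p n)" using elim by (simp add: field_simps)
      finally have "real n * - ln (1 - p n) \<le> real n * (p n / (1 - p n))"
        by (intro mult_left_mono) auto
      then show ?case by simp
    qed
    show "(\<lambda>n. - (real n * p n)) \<longlonglongrightarrow> - c" using lim by (rule tendsto_minus)
    have "(\<lambda>n. - ((real n * p n) / (1 - p n))) \<longlonglongrightarrow> - (c / (1 - 0))"
      by (intro tendsto_minus tendsto_divide lim tendsto_diff tendsto_const p0) simp
    then show "(\<lambda>n. - ((real n * p n) / (1 - p n))) \<longlonglongrightarrow> - c" by simp
  qed
  then have "(\<lambda>n. exp (real n * ln (1 - p n))) \<longlonglongrightarrow> exp (- c)" by (rule tendsto_exp)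
  moreover have "\<forall>\<^sub>F n in sequentially. exp (real n * ln (1 - p n)) = (1 - p n) ^ n"
    using small by eventually_elim (simp add: exp_of_nat_mult)
  ultimately show ?thesis by (rule Lim_transform_eventually)
qed

text \<open>Since \<open>4 * 2 powr \<alpha> > 1\<close>, doubling \<open>t\<close> eventually
  multiplies \<open>t\<^sup>2 * h t\<close> by at least some \<open>c > 1\<close>. Monotonicity of
  \<open>h\<close> gives a positive lower bound on the first dyadic interval, and iterated doubling
  carries it, times \<open>c ^ k\<close>, to the \<open>k\<close>-th.\<close>

lemma regularly_varying_square_mult_at_top:
  fixes h :: "real \<Rightarrow> real"
  assumes rv: "regularly_varying h \<alpha>" and \<alpha>: "-2 < \<alpha>"
    and mono: "antimono h" and nonneg: "\<And>t. 0 \<le> h t"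
  shows "filterlim (\<lambda>t. t\<^sup>2 * h t) at_top at_top"
proof -
  have lim: "((\<lambda>t. h (x * t) / h t) \<longlongrightarrow> x powr \<alpha>) at_top" if "x > 0" for x
    using rv that by (auto simp: regularly_varying_def)
  have "(1/4::real) = 2 powr (-2)" by (simp add: powr_minus powr_numeral)
  also have "\<dots> < 2 powr \<alpha>" using \<alpha> by (intro powr_less_mono) auto
  finally obtain \<kappa> where \<kappa>: "1/4 < \<kappa>" "\<kappa> < 2 powr \<alpha>" using dense by blast
  \<comment> \<open>The quotient with factor 1 tends to 1. As division by zero yields 0, its
    positivity rules out \<open>h t = 0\<close>.\<close>
  have "\<forall>\<^sub>F t in at_top. \<kappa> < h (2 * t) / h t \<and> 0 < h (1 * t) / h t \<and> t \<ge> 1"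
    by (intro eventually_conj order_tendstoD(1)[OF lim] eventually_ge_at_top) (use \<kappa> in auto)
  then obtain T where T: "\<And>t. t \<ge> T \<Longrightarrow> \<kappa> < h (2 * t) / h t \<and> 0 < h (1 * t) / h t \<and> t \<ge> 1"
    by (auto simp: eventually_at_top_linorder)
  have T1: "T \<ge> 1" using T[of T] by auto
  have pos: "h t > 0" if "t \<ge> T" for t
    using T[OF that] nonneg[of t] by (cases "h t = 0") auto
  define c where "c = 4 * \<kappa>"
  define g where "g t = t\<^sup>2 * h t" for t
  \<comment> \<open>Lower bound for \<open>g\<close> on \<open>{T..2 * T}\<close>, where
    \<open>t \<ge> T\<close> and \<open>h t \<ge> h (2 * T)\<close>.\<close>
  define m where "m = T\<^sup>2 * h (2 * T)"
  have c: "c > 1" using \<kappa> by (simp add: c_def)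
  have m: "m > 0" using pos[of "2 * T"] T1 by (simp add: m_def)
  have double: "c * g t \<le> g (2 * t)" if "t \<ge> T" for t
  proof -
    have "\<kappa> * h t \<le> h (2 * t)"
      using T[OF that] pos[OF that] by (simp add: pos_less_divide_eq)
    then have "4 * t\<^sup>2 * (\<kappa> * h t) \<le> 4 * t\<^sup>2 * h (2 * t)" by (intro mult_left_mono) auto
    then show ?thesis by (simp add: g_def c_def power_mult_distrib mult_ac)
  qed
  have dyadic: "c ^ k * m \<le> g t" if "2 ^ k * T \<le> t" "t \<le> 2 ^ Suc k * T" for k t
    using that
  proof (induction k arbitrary: t)
    case 0
    then have "T\<^sup>2 \<le> t\<^sup>2" using T1 by (intro power_mono) auto
    moreover have "h (2 * T) \<le> h t" using 0 by (intro antimonoD[OF mono]) auto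
    ultimately have "T\<^sup>2 * h (2 * T) \<le> t\<^sup>2 * h t" using nonneg by (intro mult_mono) auto
    then show ?case by (simp add: g_def m_def)
  next
    case (Suc k)
    have "T \<le> 2 ^ k * T" using T1 by simp
    then have "T \<le> t / 2" using Suc.prems by simp
    have "c ^ Suc k * m = c * (c ^ k * m)" by simp
    also have "\<dots> \<le> c * g (t / 2)"
      using Suc.IH[of "t / 2"] Suc.prems c by (intro mult_left_mono) auto
    also have "\<dots> \<le> g t" using double[OF \<open>T \<le> t / 2\<close>] by simp
    finally show ?case .
  qed
  have "\<forall>\<^sub>F t in at_top. Z \<le> g t" for Z
  proof -
    obtain K where K: "Z / m < c ^ K" using real_arch_pow[OF c] by blast
    show ?thesis
      using eventually_ge_at_top[of "2 ^ K * T"]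
    proof eventually_elim
      case (elim t)
      obtain N where "t / T < 2 ^ N" using real_arch_pow[of 2 "t / T"] by auto
      then have "t < 2 ^ N * T" using T1 by (simp add: pos_divide_less_eq)
      also have "\<dots> \<le> 2 ^ Suc N * T" using T1 by simp
      finally have ex: "t < 2 ^ Suc N * T" .
      \<comment> \<open>Index of the dyadic interval that contains \<open>t\<close>; the bound
        \<open>2 ^ K * T \<le> t\<close> forces \<open>K \<le> k\<close>.\<close>
      define k where "k = (LEAST k. t < 2 ^ Suc k * T)"
      have k: "t < 2 ^ Suc k * T"
        unfolding k_def by (rule LeastI[where P = "\<lambda>k. t < 2 ^ Suc k * T", OF ex])
      have "(2::real) ^ K * T < 2 ^ Suc k * T" using elim k by linarith
      then have "(2::real) ^ K < 2 ^ Suc k" using T1 by simp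
      then have "K < Suc k" by (rule power_less_imp_less_exp[rotated]) simp
      have "2 ^ k * T \<le> t"
      proof (cases k)
        case 0
        have "T \<le> 2 ^ K * T" using T1 by simp
        then show ?thesis using 0 elim by simp
      next
        case (Suc j)
        then have "\<not> t < 2 ^ Suc j * T"
          using not_less_Least[of j "\<lambda>k. t < 2 ^ Suc k * T"] by (simp add: k_def)
        then show ?thesis using Suc by simp
      qed
      then have "c ^ k * m \<le> g t" using k by (intro dyadic) auto
      moreover have "c ^ K * m \<le> c ^ k * m"
        using \<open>K < Suc k\<close> c m by (intro mult_right_mono power_increasing) auto
      moreover have "Z \<le> c ^ K * m" using K m by (simp add: pos_divide_less_eq)
      ultimately show ?case by linarith
    qed
  qed
  then show ?thesis unfolding g_def by (simp add: filterlim_at_top)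
qed

text \<open>As \<open>h\<close> may jump, \<open>n * h (\<gamma> n)\<close> need not equal 1.
  Instead 1/n is bracketed by values \<open>h (\<eta> * \<gamma> n)\<close> with \<eta> on either
  side of 1, regular variation compares these with \<open>h (z * \<gamma> n)\<close>, and \<eta> is
  moved to 1.\<close>

lemma quantile_tendsto:
  fixes h :: "real \<Rightarrow> real"
  assumes rv: "regularly_varying h \<alpha>"
    and mono: "antimono h" and nonneg: "\<And>t. 0 \<le> h t"
    and lim_top: "(h \<longlongrightarrow> 0) at_top" and lim_bot: "(h \<longlongrightarrow> 1) at_bot"
    and heavy: "filterlim (\<lambda>t. t\<^sup>2 * h t) at_top at_top"
  defines "\<gamma> \<equiv> \<lambda>n::nat. Inf {t. h t \<le> 1 / real n}"
  shows "filterlim \<gamma> at_top sequentially"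
    and "(\<lambda>n. sqrt (real n) / \<gamma> n) \<longlonglongrightarrow> 0"
    and "z > 0 \<Longrightarrow> (\<lambda>n. real n * h (z * \<gamma> n)) \<longlonglongrightarrow> z powr \<alpha>"
proof -
  \<comment> \<open>Heaviness makes \<open>h\<close> positive at arbitrarily large arguments, and
    monotonicity carries this to the left.\<close>
  have pos: "h t > 0" for t
  proof -
    have "\<forall>\<^sub>F s in at_top. 1 \<le> s\<^sup>2 * h s" using heavy by (simp add: filterlim_at_top)
    with eventually_ge_at_top[of t] have "\<forall>\<^sub>F s in at_top. t \<le> s \<and> 1 \<le> s\<^sup>2 * h s"
      by eventually_elim auto
    then obtain s where s: "t \<le> s" "1 \<le> s\<^sup>2 * h s"
      by (auto simp: eventually_at_top_linorder)
    then have "h s > 0" using nonneg[of s] by (cases "h s = 0") auto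
    then show ?thesis using antimonoD[OF mono s(1)] by linarith
  qed
  have nonempty: "{t. h t \<le> 1 / real n} \<noteq> {}" if "n > 0" for n
    using order_tendstoD(2)[OF lim_top, of "1 / real n"] that
    by (auto simp: eventually_at_top_linorder intro: less_imp_le)
  \<comment> \<open>For \<open>n = 1\<close> the set is the whole line, because
    \<open>h \<le> 1\<close>, and its \<open>Inf\<close> is meaningless. From 2 on, the limit 1 at
    \<open>at_bot\<close> bounds the set from below.\<close>
  have bdd: "bdd_below {t. h t \<le> 1 / real n}" if "n \<ge> 2" for n
  proof -
    obtain t0 where t0: "1/2 < h t0"
      using order_tendstoD(1)[OF lim_bot, of "1/2"] by (auto simp: eventually_at_bot_linorder)
    have "t0 \<le> t" if "h t \<le> 1 / real n" for t
    proof (rule ccontr)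
      assume "\<not> t0 \<le> t"
      then have "h t0 \<le> h t" by (intro antimonoD[OF mono]) auto
      moreover have "1 / real n \<le> 1/2" using \<open>n \<ge> 2\<close> by (simp add: field_simps)
      ultimately show False using t0 that by linarith
    qed
    then show ?thesis by (intro bdd_belowI[of _ t0]) auto
  qed
  show \<gamma>_top: "filterlim \<gamma> at_top sequentially"
    unfolding filterlim_at_top
  proof
    fix T
    have "\<forall>\<^sub>F n in sequentially. 1 / real n < h T"
      using order_tendstoD(2)[OF lim_1_over_n pos] .
    then show "\<forall>\<^sub>F n in sequentially. T \<le> \<gamma> n"
      using eventually_gt_at_top[of 0]
    proof eventually_elim
      case (elim n)
      show ?case unfolding \<gamma>_def
      proof (rule cInf_greatest[OF nonempty])
        fix t assume "t \<in> {t. h t \<le> 1 / real n}"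
        then have "h t < h T" using elim by auto
        then show "T \<le> t" using antimonoD[OF mono, of t T] by linarith
      qed (use elim in auto)
    qed
  qed
  \<comment> \<open>Once \<open>\<gamma> n > 0\<close>, a factor \<eta> > 1 moves beyond the infimum
    and hence beyond some member of the set; a factor \<eta> < 1, used in \<open>below\<close>,
    moves under the infimum and so out of the set.\<close>
  have above: "\<forall>\<^sub>F n in sequentially. h (\<eta> * \<gamma> n) \<le> 1 / real n" if "\<eta> > 1" for \<eta>
    using eventually_ge_at_top[of 2] filterlim_at_top_dense[THEN iffD1, OF \<gamma>_top, rule_format, of 0]
  proof eventually_elim
    case (elim n)
    have "\<gamma> n < \<eta> * \<gamma> n" using elim that by simp
    then have less: "Inf {t. h t \<le> 1 / real n} < \<eta> * \<gamma> n" by (simp only: \<gamma>_def)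
    have "n > 0" using elim by simp
    from cInf_lessD[OF nonempty[OF this] less]
    obtain t where t: "h t \<le> 1 / real n" "t < \<eta> * \<gamma> n" by blast
    then show ?case using antimonoD[OF mono, of t "\<eta> * \<gamma> n"] by linarith
  qed
  have below: "\<forall>\<^sub>F n in sequentially. 1 / real n < h (\<eta> * \<gamma> n)" if "\<eta> < 1" for \<eta>
    using eventually_ge_at_top[of 2] filterlim_at_top_dense[THEN iffD1, OF \<gamma>_top, rule_format, of 0]
  proof eventually_elim
    case (elim n)
    show ?case
    proof (rule ccontr)
      assume "\<not> 1 / real n < h (\<eta> * \<gamma> n)"
      then have "Inf {t. h t \<le> 1 / real n} \<le> \<eta> * \<gamma> n"
        by (intro cInf_lower bdd) (use elim in auto)
      then have "\<gamma> n \<le> \<eta> * \<gamma> n" by (simp only: \<gamma>_def)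
      then show False using elim that by simp
    qed
  qed
  show "(\<lambda>n. sqrt (real n) / \<gamma> n) \<longlonglongrightarrow> 0"
  proof (rule tendsto_sandwich[where f = "\<lambda>_. 0"])
    \<comment> \<open>With \<eta> = 2, \<open>above\<close> gives
      \<open>real n \<le> inverse (h (2 * \<gamma> n))\<close>. Hence the squared ratio is at most 4
      divided by \<open>t\<^sup>2 * h t\<close> at \<open>t = 2 * \<gamma> n\<close>, which vanishes
      by heaviness.\<close>
    have 2: "filterlim (\<lambda>n. 2 * \<gamma> n) at_top sequentially"
      by (rule filterlim_tendsto_pos_mult_at_top[OF tendsto_const _ \<gamma>_top]) simp
    have "filterlim (\<lambda>n. (2 * \<gamma> n)\<^sup>2 * h (2 * \<gamma> n)) at_top sequentially"
      by (rule filterlim_compose[OF heavy 2])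
    then have "(\<lambda>n. 4 * inverse ((2 * \<gamma> n)\<^sup>2 * h (2 * \<gamma> n))) \<longlonglongrightarrow> 4 * 0"
      by (intro tendsto_mult tendsto_const tendsto_inverse_0_at_top)
    from tendsto_real_sqrt[OF this]
    show "(\<lambda>n. sqrt (4 * inverse ((2 * \<gamma> n)\<^sup>2 * h (2 * \<gamma> n)))) \<longlonglongrightarrow> 0"
      by (simp only: mult_zero_right real_sqrt_zero)
    show "\<forall>\<^sub>F n in sequentially. sqrt (real n) / \<gamma> n \<le> sqrt (4 * inverse ((2 * \<gamma> n)\<^sup>2 * h (2 * \<gamma> n)))"
      using above[of 2, simplified] eventually_gt_at_top[of 0] filterlim_at_top_dense[THEN iffD1, OF \<gamma>_top, rule_format, of 0]
    proof eventually_elim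
      case (elim n)
      have "real n \<le> inverse (h (2 * \<gamma> n))"
        using elim pos[of "2 * \<gamma> n"] by (simp add: field_simps)
      then have "real n / (\<gamma> n)\<^sup>2 \<le> inverse (h (2 * \<gamma> n)) / (\<gamma> n)\<^sup>2"
        by (intro divide_right_mono) auto
      also have "\<dots> = 4 * inverse ((2 * \<gamma> n)\<^sup>2 * h (2 * \<gamma> n))"
        using elim by (simp add: field_simps)
      finally have "sqrt (real n / (\<gamma> n)\<^sup>2) \<le> sqrt (4 * inverse ((2 * \<gamma> n)\<^sup>2 * h (2 * \<gamma> n)))"
        by (rule real_sqrt_le_mono)
      then show ?case using elim by (simp add: real_sqrt_divide)
    qed
    show "\<forall>\<^sub>F n in sequentially. 0 \<le> sqrt (real n) / \<gamma> n"
      using filterlim_at_top_dense[THEN iffD1, OF \<gamma>_top, rule_format, of 0] by eventually_elim simp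
  qed simp
  assume z: "z > 0"
  have ratio: "(\<lambda>n. h (z * \<gamma> n) / h (\<eta> * \<gamma> n)) \<longlonglongrightarrow> z powr \<alpha> / \<eta> powr \<alpha>" if "\<eta> > 0" for \<eta>
  proof -
    have "((\<lambda>t. (h (z * t) / h t) / (h (\<eta> * t) / h t)) \<longlongrightarrow> z powr \<alpha> / \<eta> powr \<alpha>) at_top"
      using rv z that unfolding regularly_varying_def by (intro tendsto_divide) auto
    moreover have "(h (z * t) / h t) / (h (\<eta> * t) / h t) = h (z * t) / h (\<eta> * t)" for t
      using pos[of t] by simp
    ultimately have "((\<lambda>t. h (z * t) / h (\<eta> * t)) \<longlongrightarrow> z powr \<alpha> / \<eta> powr \<alpha>) at_top" by (simp only:)
    from filterlim_compose[OF this \<gamma>_top] show ?thesis .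
  qed
  \<comment> \<open>Continuity at \<eta> = 1 supplies some \<eta> > 1 for a given upper level (then
    \<open>above\<close> applies) and some \<eta> < 1 for a given lower level (then
    \<open>below\<close> applies).\<close>
  have cont: "((\<lambda>\<eta>. z powr \<alpha> / \<eta> powr \<alpha>) \<longlongrightarrow> z powr \<alpha> / 1 powr \<alpha>) (at 1)"
    by (intro tendsto_intros) auto
  show "(\<lambda>n. real n * h (z * \<gamma> n)) \<longlonglongrightarrow> z powr \<alpha>"
  proof (rule order_tendstoI)
    fix u assume "z powr \<alpha> < u"
    then have "\<forall>\<^sub>F \<eta> in at_right 1. z powr \<alpha> / \<eta> powr \<alpha> < u"
      using order_tendstoD(2)[OF cont, of u] by (auto simp: eventually_at_split)
    with eventually_at_right_less[of 1] have "\<forall>\<^sub>F \<eta> in at_right 1. 1 < \<eta> \<and> z powr \<alpha> / \<eta> powr \<alpha> < u"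
      by eventually_elim auto
    then obtain \<eta> where \<eta>: "1 < \<eta>" "z powr \<alpha> / \<eta> powr \<alpha> < u"
      using eventually_happens'[OF trivial_limit_at_right_real] by blast
    have "\<forall>\<^sub>F n in sequentially. h (z * \<gamma> n) / h (\<eta> * \<gamma> n) < u"
      using order_tendstoD(2)[OF ratio \<eta>(2)] \<eta>(1) by simp
    then show "\<forall>\<^sub>F n in sequentially. real n * h (z * \<gamma> n) < u"
      using above[OF \<eta>(1)] eventually_gt_at_top[of 0]
    proof eventually_elim
      case (elim n)
      have "real n \<le> inverse (h (\<eta> * \<gamma> n))"
        using elim pos[of "\<eta> * \<gamma> n"] by (simp add: field_simps)
      then have "real n * h (z * \<gamma> n) \<le> inverse (h (\<eta> * \<gamma> n)) * h (z * \<gamma> n)"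
        by (intro mult_right_mono nonneg)
      then show ?case using elim by (simp add: field_simps)
    qed
  next
    fix l assume "l < z powr \<alpha>"
    then have "\<forall>\<^sub>F \<eta> in at_left 1. l < z powr \<alpha> / \<eta> powr \<alpha>"
      using order_tendstoD(1)[OF cont, of l] by (auto simp: eventually_at_split)
    moreover have "\<forall>\<^sub>F \<eta> in at_left (1::real). 0 < \<eta> \<and> \<eta> < 1"
      by (auto intro!: eventually_at_leftI[of 0 1])
    ultimately have "\<forall>\<^sub>F \<eta> in at_left 1. (0 < \<eta> \<and> \<eta> < 1) \<and> l < z powr \<alpha> / \<eta> powr \<alpha>"
      by eventually_elim auto
    then obtain \<eta> where \<eta>: "0 < \<eta>" "\<eta> < 1" "l < z powr \<alpha> / \<eta> powr \<alpha>"
      using eventually_happens'[OF trivial_limit_at_left_real] by blast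
    have "\<forall>\<^sub>F n in sequentially. l < h (z * \<gamma> n) / h (\<eta> * \<gamma> n)"
      using order_tendstoD(1)[OF ratio \<eta>(3)] \<eta>(1) by simp
    then show "\<forall>\<^sub>F n in sequentially. l < real n * h (z * \<gamma> n)"
      using below[OF \<eta>(2)] eventually_gt_at_top[of 0]
    proof eventually_elim
      case (elim n)
      have "inverse (h (\<eta> * \<gamma> n)) \<le> real n"
        using elim pos[of "\<eta> * \<gamma> n"] by (simp add: field_simps)
      then have "inverse (h (\<eta> * \<gamma> n)) * h (z * \<gamma> n) \<le> real n * h (z * \<gamma> n)"
        by (intro mult_right_mono nonneg)
      then show ?case using elim by (simp add: field_simps)
    qed
  qed
qed

subsection \<open>The standard normal distribution\<close>

text \<open>Absence of atoms makes the normal cdf continuous and the half-lines \<open>{t..}\<close>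
  continuity sets for weak convergence.\<close>

lemma std_normal_emeasure_singleton: "emeasure std_normal_distribution {x} = 0"
proof -
  have "emeasure std_normal_distribution {x} = (\<integral>\<^sup>+y. ennreal (std_normal_density y) * indicator {x} y \<partial>lborel)"
    by (simp add: emeasure_density)
  also have "\<dots> = 0"
  proof (rule nn_integral_0_iff_AE[THEN iffD2])
    have "AE y in lborel. y \<noteq> x" by (rule AE_lborel_singleton)
    then show "AE y in lborel. ennreal (std_normal_density y) * indicator {x} y = 0"
      by eventually_elim simp
  qed measurable
  finally show ?thesis .
qed

lemma std_normal_measure_singleton: "measure std_normal_distribution {x} = 0"
  by (simp add: measure_def std_normal_emeasure_singleton)

lemma isCont_std_normal_cdf: "isCont (cdf std_normal_distribution) x"
  using finite_borel_measure.isCont_cdf[OF real_distribution.finite_borel_measure_M[OF real_dist_normal_dist]]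
  by (simp add: std_normal_measure_singleton)

lemma std_normal_measure_atLeast: "measure std_normal_distribution {x..} = 1 - cdf std_normal_distribution x"
proof -
  interpret N: real_distribution std_normal_distribution by (rule real_dist_normal_dist)
  have "measure std_normal_distribution (UNIV - {..x}) = 1 - cdf std_normal_distribution x"
    using N.prob_compl[of "{..x}"] by (simp add: cdf_def)
  moreover have "measure std_normal_distribution {x..} = measure std_normal_distribution ({x} \<union> (UNIV - {..x}))"
    by (rule arg_cong[where f = "measure _"]) auto
  moreover have "\<dots> = measure std_normal_distribution {x} + measure std_normal_distribution (UNIV - {..x})"
    by (rule N.finite_measure_Union) auto
  ultimately show ?thesis by (simp add: std_normal_measure_singleton)
qed

lemma std_normal_measure_eq_integral:
  assumes [measurable]: "A \<in> sets borel"
  shows "measure std_normal_distribution A = (\<integral>x. std_normal_density x * indicator A x \<partial>lborel)"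
proof -
  have "integrable lborel (\<lambda>x. indicator A x *\<^sub>R std_normal_density x)"
    by (rule integrable_mult_indicator) auto
  then have int: "integrable lborel (\<lambda>x. std_normal_density x * indicator A x)"
    by (simp add: mult.commute)
  have "emeasure std_normal_distribution A = (\<integral>\<^sup>+x. ennreal (std_normal_density x) * indicator A x \<partial>lborel)"
    by (simp add: emeasure_density)
  also have "\<dots> = (\<integral>\<^sup>+x. ennreal (std_normal_density x * indicator A x) \<partial>lborel)"
    by (intro nn_integral_cong) (simp split: split_indicator)
  also have "\<dots> = ennreal (\<integral>x. std_normal_density x * indicator A x \<partial>lborel)"
    by (rule nn_integral_eq_integral[OF int]) simp
  finally have "emeasure std_normal_distribution A = ennreal (\<integral>x. std_normal_density x * indicator A x \<partial>lborel)" .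
  moreover have "(\<integral>x. std_normal_density x * indicator A x \<partial>lborel) \<ge> 0"
    by (rule Bochner_Integration.integral_nonneg) simp
  ultimately show ?thesis by (simp add: measure_def)
qed

text \<open>Reflection at 0 preserves the density and swaps the two half-lines, whose masses add up
  to 1 because 0 is not an atom.\<close>

lemma std_normal_cdf_0: "cdf std_normal_distribution 0 = 1 / 2"
proof -
  have "(\<integral>x. std_normal_density x * indicator {..0} x \<partial>lborel)
      = (\<integral>x. std_normal_density (0 + -1 * x) * indicator {..0} (0 + -1 * x) \<partial>lborel)"
    by (subst lborel_integral_real_affine[of "-1" _ 0]) auto
  also have "\<dots> = (\<integral>x. std_normal_density x * indicator {0..} x \<partial>lborel)"
    by (intro Bochner_Integration.integral_cong) (auto simp: std_normal_density_def indicator_def)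
  finally have "cdf std_normal_distribution 0 = measure std_normal_distribution {0..}"
    unfolding cdf_def by (simp add: std_normal_measure_eq_integral)
  then show ?thesis by (simp add: std_normal_measure_atLeast)
qed

text \<open>The mass 1/2 below 0 is split off, and the rest passes from the Lebesgue integral to the
  gauge \<open>integral\<close> of the definition. Doubling turns the constant
  \<open>1 / sqrt (2 * pi)\<close> into \<open>sqrt (2 / pi)\<close>.\<close>

lemma abs_normal_cdf_eq: "y \<ge> 0 \<Longrightarrow> abs_normal_cdf y = 2 * cdf std_normal_distribution y - 1"
proof -
  assume y: "y \<ge> 0"
  interpret N: real_distribution std_normal_distribution by (rule real_dist_normal_dist)
  have "cdf std_normal_distribution y = measure std_normal_distribution ({..<0} \<union> {0..y})"
    unfolding cdf_def by (rule arg_cong[where f = "measure _"]) (use y in auto)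
  also have "\<dots> = measure std_normal_distribution {..<0} + measure std_normal_distribution {0..y}"
    by (rule N.finite_measure_Union) auto
  also have "measure std_normal_distribution {..<0} = 1 / 2"
    using N.prob_compl[of "{0..}"] std_normal_measure_atLeast[of 0]
    by (simp add: std_normal_cdf_0 Compl_eq_Diff_UNIV[symmetric] Compl_atLeast)
  also have "measure std_normal_distribution {0..y} = integral {0..y} std_normal_density"
  proof -
    have "set_integrable lborel {0..y} std_normal_density"
      unfolding set_integrable_def by (rule integrable_mult_indicator) auto
    from set_borel_integral_eq_integral(2)[OF this] show ?thesis
      by (simp add: std_normal_measure_eq_integral set_lebesgue_integral_def mult.commute)
  qed
  also have "\<dots> = (1 / sqrt (2 * pi)) * integral {0..y} (\<lambda>t. exp (- (t\<^sup>2) / 2))"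
    unfolding std_normal_density_def[abs_def] by (rule integral_mult_right)
  finally have "2 * cdf std_normal_distribution y - 1 = 2 / sqrt (2 * pi) * integral {0..y} (\<lambda>t. exp (- (t\<^sup>2) / 2))"
    by simp
  moreover have "2 / sqrt (2 * pi) = sqrt (2 / pi)"
    by (simp add: real_sqrt_mult real_sqrt_divide field_simps)
  ultimately show ?thesis using y by (simp add: abs_normal_cdf_def)
qed

subsection \<open>Convergence criterion and tails\<close>

text \<open>Logarithms turn the power into a threshold \<open>ln x * c n\<close>. If
  \<open>ln x \<le> 0\<close>, the probability is dominated by those at thresholds
  \<open>d * c n\<close> with small \<open>d > 0\<close>, whose limits \<open>F d\<close> tend to 0;
  so \<open>lim\<close> is asked for positive \<open>y\<close> only. Positivity starts at
  \<open>n = 1\<close> because \<open>perp_R\<close> vanishes at 0.\<close>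

lemma (in prob_space) conv_distr_to_exp_cdf:
  assumes [measurable]: "\<And>n. R n \<in> borel_measurable M"
    and pos: "\<And>n \<omega>. n \<ge> 1 \<Longrightarrow> 0 < R n \<omega>"
    and c: "\<forall>\<^sub>F n in sequentially. 0 < c n"
    and lim: "\<And>y. y > 0 \<Longrightarrow> (\<lambda>n. prob {\<omega> \<in> space M. ln (R n \<omega>) \<le> y * c n}) \<longlonglongrightarrow> F y"
    and F_0: "(F \<longlongrightarrow> 0) (at_right 0)" and F_neg: "\<And>y. y \<le> 0 \<Longrightarrow> F y = 0"
  shows "conv_distr_to M (\<lambda>n \<omega>. R n \<omega> powr (1 / c n)) (exp_cdf F)"
  unfolding conv_distr_to_def weak_conv_def
proof safe
  fix x :: real
  have cdf: "cdf (distr M borel (\<lambda>\<omega>. R n \<omega> powr (1 / c n))) x = prob {\<omega> \<in> space M. R n \<omega> powr (1 / c n) \<le> x}" for n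
    by (simp add: cdf_def measure_distr vimage_def Int_def conj_commute)
  show "(\<lambda>n. cdf (distr M borel (\<lambda>\<omega>. R n \<omega> powr (1 / c n))) x) \<longlonglongrightarrow> exp_cdf F x"
  proof (cases "x \<le> 0")
    case True
    have "\<forall>\<^sub>F n in sequentially. prob {\<omega> \<in> space M. R n \<omega> powr (1 / c n) \<le> x} = 0"
      using eventually_ge_at_top[of 1]
    proof eventually_elim
      case (elim n)
      have "x < R n \<omega> powr (1 / c n)" for \<omega>
        using True pos[OF elim, of \<omega>] by (intro le_less_trans[of x 0]) auto
      then have "{\<omega> \<in> space M. R n \<omega> powr (1 / c n) \<le> x} = {}" by (auto simp: not_le)
      then show ?case by (metis measure_empty)
    qed
    then show ?thesis unfolding cdf using True by (simp add: exp_cdf_def tendsto_eventually)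
  next
    case False
    then have x: "x > 0" by simp
    have eq: "\<forall>\<^sub>F n in sequentially. prob {\<omega> \<in> space M. ln (R n \<omega>) \<le> ln x * c n} = prob {\<omega> \<in> space M. R n \<omega> powr (1 / c n) \<le> x}"
      using c eventually_ge_at_top[of 1]
    proof eventually_elim
      case (elim n)
      have "ln (R n \<omega>) \<le> ln x * c n \<longleftrightarrow> R n \<omega> powr (1 / c n) \<le> x" for \<omega>
      proof -
        have "R n \<omega> powr (1 / c n) \<le> x \<longleftrightarrow> ln (R n \<omega> powr (1 / c n)) \<le> ln x"
          using x pos[OF elim(2), of \<omega>] by (subst ln_le_cancel_iff) auto
        also have "\<dots> \<longleftrightarrow> ln (R n \<omega>) \<le> ln x * c n"
          using elim(1) by (simp add: ln_powr pos_divide_le_eq)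
        finally show ?thesis by simp
      qed
      then show ?case by simp
    qed
    have "(\<lambda>n. prob {\<omega> \<in> space M. ln (R n \<omega>) \<le> ln x * c n}) \<longlonglongrightarrow> F (ln x)"
    proof (cases "ln x > 0")
      case True
      then show ?thesis by (rule lim)
    next
      case False
      have "(\<lambda>n. prob {\<omega> \<in> space M. ln (R n \<omega>) \<le> ln x * c n}) \<longlonglongrightarrow> 0"
      proof (rule order_tendstoI)
        fix u :: real assume "0 < u"
        from order_tendstoD(2)[OF F_0 this] eventually_at_right_less[of 0]
        have "\<forall>\<^sub>F d in at_right 0. F d < u \<and> 0 < d" by (rule eventually_conj)
        then obtain d where d: "F d < u" "0 < d"
          using eventually_happens'[OF trivial_limit_at_right_real] by blast
        show "\<forall>\<^sub>F n in sequentially. prob {\<omega> \<in> space M. ln (R n \<omega>) \<le> ln x * c n} < u"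
          using order_tendstoD(2)[OF lim[OF d(2)] d(1)] c
        proof eventually_elim
          case (elim n)
          have "ln x * c n \<le> d * c n" using False d elim by (intro mult_right_mono) auto
          then have "prob {\<omega> \<in> space M. ln (R n \<omega>) \<le> ln x * c n} \<le> prob {\<omega> \<in> space M. ln (R n \<omega>) \<le> d * c n}"
            by (intro finite_measure_mono) auto
          then show ?case using elim by linarith
        qed
      next
        fix l :: real assume "l < 0"
        then show "\<forall>\<^sub>F n in sequentially. l < prob {\<omega> \<in> space M. ln (R n \<omega>) \<le> ln x * c n}"
          by (intro always_eventually allI) (rule less_le_trans[OF _ measure_nonneg])
      qed
      then show ?thesis using False by (simp add: F_neg)
    qed
    from Lim_transform_eventually[OF this eq] show ?thesis
      unfolding cdf using x by (simp add: exp_cdf_def)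
  qed
qed

text \<open>Chebyshev's inequality gives boundedness only. Keeping the indicator of
  \<open>t < f \<omega>\<close> inside the second moment gives a bound that vanishes by dominated
  convergence.\<close>

lemma (in prob_space) second_moment_tail:
  assumes [measurable]: "f \<in> borel_measurable M" and int: "integrable M (\<lambda>\<omega>. (f \<omega>)\<^sup>2)"
  shows "((\<lambda>t. t\<^sup>2 * prob {\<omega> \<in> space M. t < f \<omega>}) \<longlongrightarrow> 0) at_top"
proof -
  let ?g = "\<lambda>t \<omega>. indicator {\<omega> \<in> space M. t < f \<omega>} \<omega> * (f \<omega>)\<^sup>2"
  have lim: "((\<lambda>t. expectation (?g t)) \<longlongrightarrow> 0) at_top"
  proof -
    have "((\<lambda>t. expectation (?g t)) \<longlongrightarrow> expectation (\<lambda>_. 0)) at_top"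
    proof (rule integral_dominated_convergence_at_top[where w = "\<lambda>\<omega>. (f \<omega>)\<^sup>2"])
      show "AE \<omega> in M. ((\<lambda>t. ?g t \<omega>) \<longlongrightarrow> 0) at_top"
      proof (rule AE_I2)
        fix \<omega>
        have "\<forall>\<^sub>F t in at_top. ?g t \<omega> = 0"
          using eventually_ge_at_top[of "f \<omega>"] by eventually_elim auto
        then show "((\<lambda>t. ?g t \<omega>) \<longlongrightarrow> 0) at_top" by (rule tendsto_eventually)
      qed
    qed (auto simp: int indicator_def)
    then show ?thesis by simp
  qed
  have le: "\<forall>\<^sub>F t in at_top. t\<^sup>2 * prob {\<omega> \<in> space M. t < f \<omega>} \<le> expectation (?g t)"
    using eventually_ge_at_top[of 0]
  proof eventually_elim
    case (elim t)
    have "t\<^sup>2 * prob {\<omega> \<in> space M. t < f \<omega>} = expectation (\<lambda>\<omega>. t\<^sup>2 * indicator {\<omega> \<in> space M. t < f \<omega>} \<omega>)"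
      by simp
    also have "\<dots> \<le> expectation (?g t)"
    proof (rule integral_mono)
      show "integrable M (?g t)"
        using integrable_mult_indicator[OF _ int, of "{\<omega> \<in> space M. t < f \<omega>}"] by simp
      show "t\<^sup>2 * indicator {\<omega> \<in> space M. t < f \<omega>} \<omega> \<le> ?g t \<omega>" for \<omega>
        using elim by (auto simp: indicator_def intro: power_mono)
    qed (simp add: less_top[symmetric])
    finally show ?case .
  qed
  show ?thesis
    by (rule tendsto_sandwich[OF _ le tendsto_const lim]) simp
qed

subsection \<open>The perpetuity and its first passage times\<close>

lemma measurable_component_fst:
  "i \<in> I \<Longrightarrow> (\<lambda>f. fst (f i)) \<in> PiM I (\<lambda>_. N1 \<Otimes>\<^sub>M N2) \<rightarrow>\<^sub>M N1"
  by (rule measurable_compose[OF _ measurable_fst], rule measurable_component_singleton)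

lemma measurable_component_snd:
  "i \<in> I \<Longrightarrow> (\<lambda>f. snd (f i)) \<in> PiM I (\<lambda>_. N1 \<Otimes>\<^sub>M N2) \<rightarrow>\<^sub>M N2"
  by (rule measurable_compose[OF _ measurable_snd], rule measurable_component_singleton)

text \<open>The recursion uses indices from 1 on, so the pair with index 0 can serve as the generic
  copy of \<open>(X, Y)\<close>. The locale form allows a second instance with the walk
  reflected.\<close>

locale perpetuity = prob_space +
  fixes Xs Ys :: "nat \<Rightarrow> 'a \<Rightarrow> real" and v :: real
  assumes indep: "indep_vars (\<lambda>_. borel \<Otimes>\<^sub>M borel) (\<lambda>k \<omega>. (Xs k \<omega>, Ys k \<omega>)) UNIV"
    and ident: "\<And>k. distr M (borel \<Otimes>\<^sub>M borel) (\<lambda>\<omega>. (Xs k \<omega>, Ys k \<omega>))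
                  = distr M (borel \<Otimes>\<^sub>M borel) (\<lambda>\<omega>. (Xs 0 \<omega>, Ys 0 \<omega>))"
    and mean: "expectation (Xs 0) = 0"
    and square_integrable: "integrable M (\<lambda>\<omega>. (Xs 0 \<omega>)\<^sup>2)"
    and v_pos: "v > 0"
    and var: "variance (Xs 0) = v\<^sup>2"
begin

definition S :: "nat \<Rightarrow> 'a \<Rightarrow> real" where
  "S m \<omega> = (\<Sum>j\<in>{1..m}. Xs j \<omega>)"

definition D :: "nat \<Rightarrow> nat \<Rightarrow> 'a \<Rightarrow> real" where
  "D n k \<omega> = (\<Sum>j\<in>{k<..n}. Xs j \<omega>)"

lemma pair_measurable: "(\<lambda>\<omega>. (Xs k \<omega>, Ys k \<omega>)) \<in> M \<rightarrow>\<^sub>M borel \<Otimes>\<^sub>M borel"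
  using indep unfolding indep_vars_def2 by auto

lemma Xs_measurable [measurable]: "Xs k \<in> borel_measurable M"
  using measurable_compose[OF pair_measurable measurable_fst, of k] by simp

lemma Ys_measurable [measurable]: "Ys k \<in> borel_measurable M"
  using measurable_compose[OF pair_measurable measurable_snd, of k] by simp

lemma S_measurable [measurable]: "S m \<in> borel_measurable M"
  unfolding S_def[abs_def] by measurable

lemma D_measurable [measurable]: "D n k \<in> borel_measurable M"
  unfolding D_def[abs_def] by measurable

lemma perp_R_measurable [measurable]: "perp_R Xs Ys n \<in> borel_measurable M"
proof (induction n)
  case (Suc n)
  then show ?case by (simp add: perp_R.simps[abs_def])
qed (simp add: perp_R.simps[abs_def])

lemma distr_Xs: "distr M borel (Xs k) = distr M borel (Xs 0)"
proof -
  have "distr M borel (Xs i) = distr (distr M (borel \<Otimes>\<^sub>M borel) (\<lambda>\<omega>. (Xs i \<omega>, Ys i \<omega>))) borel fst" for i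
    by (subst distr_distr) (auto simp: comp_def)
  then show ?thesis by (metis ident)
qed

lemma distr_Ys: "distr M borel (Ys k) = distr M borel (Ys 0)"
proof -
  have "distr M borel (Ys i) = distr (distr M (borel \<Otimes>\<^sub>M borel) (\<lambda>\<omega>. (Xs i \<omega>, Ys i \<omega>))) borel snd" for i
    by (subst distr_distr) (auto simp: comp_def)
  then show ?thesis by (metis ident)
qed

lemma prob_Xs: "A \<in> sets borel \<Longrightarrow> prob {\<omega> \<in> space M. Xs k \<omega> \<in> A} = prob {\<omega> \<in> space M. Xs 0 \<omega> \<in> A}"
  using arg_cong[OF distr_Xs[of k], of "\<lambda>N. measure N A"]
  by (simp add: measure_distr vimage_def Int_def conj_commute)

lemma prob_Ys: "A \<in> sets borel \<Longrightarrow> prob {\<omega> \<in> space M. Ys k \<omega> \<in> A} = prob {\<omega> \<in> space M. Ys 0 \<omega> \<in> A}"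
  using arg_cong[OF distr_Ys[of k], of "\<lambda>N. measure N A"]
  by (simp add: measure_distr vimage_def Int_def conj_commute)

lemma perp_R_eq_sum: "perp_R Xs Ys n \<omega> = (\<Sum>k\<in>{1..n}. exp (Ys k \<omega> + D n k \<omega>))"
proof (induction n)
  case (Suc n)
  have "D (Suc n) k \<omega> = Xs (Suc n) \<omega> + D n k \<omega>" if "k \<in> {1..n}" for k
  proof -
    have "{k<..Suc n} = insert (Suc n) {k<..n}" using that by auto
    then show ?thesis by (simp add: D_def)
  qed
  moreover have "D (Suc n) (Suc n) \<omega> = 0" by (simp add: D_def)
  ultimately show ?case
    by (simp add: Suc exp_add sum_distrib_left mult_ac)
qed simp

lemma perp_R_ge: "k \<in> {1..n} \<Longrightarrow> exp (Ys k \<omega> + D n k \<omega>) \<le> perp_R Xs Ys n \<omega>"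
  unfolding perp_R_eq_sum by (rule member_le_sum) auto

lemma perp_R_pos: "n \<ge> 1 \<Longrightarrow> perp_R Xs Ys n \<omega> > 0"
  unfolding perp_R_eq_sum by (rule sum_pos) auto

lemma ln_perp_R_ge: "k \<in> {1..n} \<Longrightarrow> Ys k \<omega> + D n k \<omega> \<le> ln (perp_R Xs Ys n \<omega>)"
  using perp_R_ge[of k n \<omega>] perp_R_pos[of n \<omega>] by (simp add: ln_ge_iff)

text \<open>The \<open>n\<close> summands are each at most \<open>exp u\<close>; this is the source
  of the error \<open>ln n\<close>.\<close>

lemma ln_perp_R_le:
  assumes "n \<ge> 1" "\<And>k. k \<in> {1..n} \<Longrightarrow> Ys k \<omega> + D n k \<omega> \<le> u"
  shows "ln (perp_R Xs Ys n \<omega>) \<le> ln (real n) + u"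
proof -
  have "perp_R Xs Ys n \<omega> \<le> (\<Sum>k\<in>{1..n}. exp u)"
    unfolding perp_R_eq_sum by (rule sum_mono) (use assms(2) in auto)
  also have "\<dots> = exp (ln (real n) + u)"
    using assms(1) by (simp add: exp_add)
  finally have "ln (perp_R Xs Ys n \<omega>) \<le> ln (exp (ln (real n) + u))"
    using perp_R_pos[of n \<omega>] assms(1) by (subst ln_le_cancel_iff) auto
  then show ?thesis by simp
qed

lemma S_eq_add_D: "k \<le> n \<Longrightarrow> S n \<omega> = S k \<omega> + D n k \<omega>"
proof -
  assume "k \<le> n"
  then have "{1..n} = {1..k} \<union> {k<..n}" by auto
  moreover have "{1..k} \<inter> {k<..n} = {}" by auto
  ultimately show ?thesis by (simp add: S_def D_def sum.union_disjoint)
qed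

text \<open>Events are predicates on blocks of pairs, so one block may involve \<open>Xs\<close> and
  \<open>Ys\<close> jointly; the two coordinates of a pair may be dependent.\<close>

lemma prob_indep_blocks:
  assumes "A \<inter> B = {}"
    and [measurable]: "Measurable.pred (PiM A (\<lambda>_. borel \<Otimes>\<^sub>M borel)) P"
    and [measurable]: "Measurable.pred (PiM B (\<lambda>_. borel \<Otimes>\<^sub>M borel)) Q"
  shows "prob {\<omega> \<in> space M. P (\<lambda>i\<in>A. (Xs i \<omega>, Ys i \<omega>)) \<and> Q (\<lambda>i\<in>B. (Xs i \<omega>, Ys i \<omega>))}
    = prob {\<omega> \<in> space M. P (\<lambda>i\<in>A. (Xs i \<omega>, Ys i \<omega>))} * prob {\<omega> \<in> space M. Q (\<lambda>i\<in>B. (Xs i \<omega>, Ys i \<omega>))}"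
proof -
  let ?ZA = "\<lambda>\<omega>. \<lambda>i\<in>A. (Xs i \<omega>, Ys i \<omega>)" and ?ZB = "\<lambda>\<omega>. \<lambda>i\<in>B. (Xs i \<omega>, Ys i \<omega>)"
  let ?MA = "PiM A (\<lambda>_. borel \<Otimes>\<^sub>M borel :: (real \<times> real) measure)"
  let ?MB = "PiM B (\<lambda>_. borel \<Otimes>\<^sub>M borel :: (real \<times> real) measure)"
  have iv: "indep_var ?MA ?ZA ?MB ?ZB"
    using indep_var_restrict[OF indep assms(1)] by simp
  have ZA: "?ZA \<in> M \<rightarrow>\<^sub>M ?MA" and ZB: "?ZB \<in> M \<rightarrow>\<^sub>M ?MB"
    using indep_var_rv1[OF iv] indep_var_rv2[OF iv] .
  have "prob ((\<lambda>x. (?ZA x, ?ZB x)) -` ({f \<in> space ?MA. P f} \<times> {f \<in> space ?MB. Q f}) \<inter> space M)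
      = prob (?ZA -` {f \<in> space ?MA. P f} \<inter> space M) * prob (?ZB -` {f \<in> space ?MB. Q f} \<inter> space M)"
    by (rule indep_varD[OF iv]) auto
  moreover have "(\<lambda>x. (?ZA x, ?ZB x)) -` ({f \<in> space ?MA. P f} \<times> {f \<in> space ?MB. Q f}) \<inter> space M
     = {\<omega> \<in> space M. P (?ZA \<omega>) \<and> Q (?ZB \<omega>)}"
    using measurable_space[OF ZA] measurable_space[OF ZB] by auto
  moreover have "?ZA -` {f \<in> space ?MA. P f} \<inter> space M = {\<omega> \<in> space M. P (?ZA \<omega>)}"
    using measurable_space[OF ZA] by auto
  moreover have "?ZB -` {f \<in> space ?MB. Q f} \<inter> space M = {\<omega> \<in> space M. Q (?ZB \<omega>)}"
    using measurable_space[OF ZB] by auto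
  ultimately show ?thesis by simp
qed

text \<open>Time runs downwards from \<open>n\<close>: \<open>k\<close> is the first time at which \<open>D n k\<close> reaches \<open>b\<close>,
  and this event does not involve the pairs with indices in \<open>{1..k}\<close>.\<close>
definition first_passage :: "nat \<Rightarrow> real \<Rightarrow> nat \<Rightarrow> 'a \<Rightarrow> bool" where
  "first_passage n b k \<omega> \<longleftrightarrow> b \<le> D n k \<omega> \<and> (\<forall>i\<in>{k<..n}. D n i \<omega> < b)"

lemma first_passage_measurable [measurable]: "Measurable.pred M (first_passage n b k)"
  unfolding first_passage_def[abs_def] by measurable

lemma first_passage_unique:
  assumes "first_passage n b k \<omega>" "first_passage n b l \<omega>" "k \<in> {1..n}" "l \<in> {1..n}"
  shows "k = l"
  using assms unfolding first_passage_def
  by (metis atLeastAtMost_iff greaterThanAtMost_iff linorder_neqE_nat not_le)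

lemma first_passage_exists:
  "(\<exists>k\<in>{1..n}. b \<le> D n k \<omega>) \<longleftrightarrow> (\<exists>k\<in>{1..n}. first_passage n b k \<omega>)"
proof
  assume *: "\<exists>k\<in>{1..n}. b \<le> D n k \<omega>"
  \<comment> \<open>As time runs downwards, the first passage is the largest index at which the
    level is reached.\<close>
  let ?K = "{k\<in>{1..n}. b \<le> D n k \<omega>}"
  have fin: "finite ?K" by simp
  have "Max ?K \<in> ?K" by (rule Max_in) (use * in auto)
  moreover have "D n i \<omega> < b" if "i \<in> {Max ?K<..n}" for i
    using Max_ge[OF fin, of i] that by fastforce
  ultimately show "\<exists>k\<in>{1..n}. first_passage n b k \<omega>"
    unfolding first_passage_def by auto
qed (auto simp: first_passage_def)

text \<open>The passage event reads the coordinates in \<open>{k<..n}\<close> and \<open>Q\<close>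
  those in \<open>{1..k}\<close>, which are disjoint blocks. \<open>P\<close> restates the event on
  its own block.\<close>

lemma prob_first_passage_indep:
  assumes [measurable]: "Measurable.pred (PiM {1..k} (\<lambda>_. borel \<Otimes>\<^sub>M borel)) Q"
  shows "prob {\<omega> \<in> space M. first_passage n b k \<omega> \<and> Q (\<lambda>i\<in>{1..k}. (Xs i \<omega>, Ys i \<omega>))}
    = prob {\<omega> \<in> space M. first_passage n b k \<omega>} * prob {\<omega> \<in> space M. Q (\<lambda>i\<in>{1..k}. (Xs i \<omega>, Ys i \<omega>))}"
proof -
  define P where "P f \<longleftrightarrow> b \<le> (\<Sum>j\<in>{k<..n}. fst (f j)) \<and> (\<forall>i\<in>{k<..n}. (\<Sum>j\<in>{i<..n}. fst (f j)) < b)"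
    for f :: "nat \<Rightarrow> real \<times> real"
  have [measurable]: "(\<lambda>f. \<Sum>j\<in>{i<..n}. fst (f j)) \<in> PiM {k<..n} (\<lambda>_. borel \<Otimes>\<^sub>M borel) \<rightarrow>\<^sub>M (borel :: real measure)"
    if "k \<le> i" for i
    using that by (intro borel_measurable_sum measurable_component_fst) auto
  have Pm: "Measurable.pred (PiM {k<..n} (\<lambda>_. borel \<Otimes>\<^sub>M borel)) P"
  proof -
    have [measurable]: "Measurable.pred (PiM {k<..n} (\<lambda>_. borel \<Otimes>\<^sub>M borel))
        (\<lambda>f. \<forall>i\<in>{k<..n}. (\<Sum>j\<in>{i<..n}. fst (f j)) < b)"
      by (rule pred_intros_finite) (simp, measurable)
    show ?thesis unfolding P_def[abs_def] by measurable
  qed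
  have eq: "first_passage n b k \<omega> \<longleftrightarrow> P (\<lambda>i\<in>{k<..n}. (Xs i \<omega>, Ys i \<omega>))" for \<omega>
    unfolding first_passage_def P_def D_def by (auto intro!: sum.cong)
  show ?thesis
    unfolding eq by (rule prob_indep_blocks[OF _ Pm assms]) auto
qed

text \<open>The strong Markov property of the reversed walk: passage indices are unique, so the
  event splits into disjoint pieces, and each piece factorises.\<close>

lemma prob_first_passage:
  assumes [measurable]: "\<And>k. Measurable.pred (PiM {1..k} (\<lambda>_. borel \<Otimes>\<^sub>M borel)) (Q k)"
  shows "prob {\<omega> \<in> space M. \<exists>k\<in>{1..n}. first_passage n b k \<omega> \<and> Q k (\<lambda>i\<in>{1..k}. (Xs i \<omega>, Ys i \<omega>))}
    = (\<Sum>k\<in>{1..n}. prob {\<omega> \<in> space M. first_passage n b k \<omega>}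
         * prob {\<omega> \<in> space M. Q k (\<lambda>i\<in>{1..k}. (Xs i \<omega>, Ys i \<omega>))})"
proof -
  let ?E = "\<lambda>k. {\<omega> \<in> space M. first_passage n b k \<omega> \<and> Q k (\<lambda>i\<in>{1..k}. (Xs i \<omega>, Ys i \<omega>))}"
  have "{\<omega> \<in> space M. \<exists>k\<in>{1..n}. first_passage n b k \<omega> \<and> Q k (\<lambda>i\<in>{1..k}. (Xs i \<omega>, Ys i \<omega>))} = (\<Union>k\<in>{1..n}. ?E k)"
    by auto
  also have "prob \<dots> = (\<Sum>k\<in>{1..n}. prob (?E k))"
  proof (rule finite_measure_finite_Union)
    show "?E ` {1..n} \<subseteq> events"
    proof -
      have [measurable]: "(\<lambda>\<omega>. \<lambda>i\<in>{1..k}. (Xs i \<omega>, Ys i \<omega>)) \<in> M \<rightarrow>\<^sub>M PiM {1..k} (\<lambda>_. borel \<Otimes>\<^sub>M borel)" for k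
        by (rule measurable_restrict[OF pair_measurable])
      have "?E k \<in> events" for k by measurable
      then show ?thesis by blast
    qed
    show "disjoint_family_on ?E {1..n}"
      unfolding disjoint_family_on_def using first_passage_unique by blast
  qed simp
  finally show ?thesis by (simp only: prob_first_passage_indep[OF assms])
qed

lemma prob_max_D:
  "prob {\<omega> \<in> space M. \<exists>k\<in>{1..n}. b \<le> D n k \<omega>} = (\<Sum>k\<in>{1..n}. prob {\<omega> \<in> space M. first_passage n b k \<omega>})"
  unfolding first_passage_exists using prob_first_passage[of "\<lambda>_ _. True" n b] by (simp add: prob_space)

section \<open>Approximate reflection: the maximum of the reversed walk against its endpoint\<close>

lemma S_block_measurable:
  "(\<lambda>f. \<Sum>j\<in>{1..k}. fst (f j)) \<in> PiM {1..k} (\<lambda>_. borel \<Otimes>\<^sub>M borel) \<rightarrow>\<^sub>M (borel :: real measure)"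
  by (intro borel_measurable_sum measurable_component_fst)

lemma S_block: "S k \<omega> = (\<Sum>j\<in>{1..k}. fst ((\<lambda>i\<in>{1..k}. (Xs i \<omega>, Ys i \<omega>)) j))"
  unfolding S_def by (auto intro!: sum.cong)

text \<open>After passage at \<open>k\<close>, the independent remainder satisfies
  \<open>- r \<le> S k\<close> with probability at least \<open>q\<close>, and then
  \<open>S n = S k + D n k\<close> stays above \<open>b - r\<close>.\<close>

lemma prob_max_D_le:
  assumes q: "\<And>m. q \<le> prob {\<omega> \<in> space M. - r \<le> S m \<omega>}"
  shows "q * prob {\<omega> \<in> space M. \<exists>k\<in>{1..n}. b \<le> D n k \<omega>} \<le> prob {\<omega> \<in> space M. b - r \<le> S n \<omega>}"
proof -
  have "q * prob {\<omega> \<in> space M. \<exists>k\<in>{1..n}. b \<le> D n k \<omega>}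
      \<le> (\<Sum>k\<in>{1..n}. prob {\<omega> \<in> space M. first_passage n b k \<omega>} * prob {\<omega> \<in> space M. - r \<le> S k \<omega>})"
    unfolding prob_max_D sum_distrib_left
    by (intro sum_mono) (auto simp: mult.commute[of q] intro: mult_left_mono[OF q] mult_right_mono[OF q])
  also have "\<dots> = prob {\<omega> \<in> space M. \<exists>k\<in>{1..n}. first_passage n b k \<omega> \<and> - r \<le> S k \<omega>}"
    unfolding S_block
    by (subst prob_first_passage[symmetric]) (use S_block_measurable in measurable)
  also have "\<dots> \<le> prob {\<omega> \<in> space M. b - r \<le> S n \<omega>}"
    by (rule finite_measure_mono) (auto simp: first_passage_def S_eq_add_D)
  finally show ?thesis .
qed

text \<open>If no step exceeds \<open>r\<close>, the passage overshoots \<open>b\<close> by at most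
  \<open>r\<close>, so \<open>b + 2 * r \<le> S n\<close> leaves at least \<open>r\<close> for the
  independent remainder \<open>S k\<close>. The union bound for large steps gives the last
  term.\<close>

lemma prob_max_D_ge:
  assumes q: "\<And>m. prob {\<omega> \<in> space M. r \<le> S m \<omega>} \<le> q" and b: "b > 0" and r: "r > 0"
  shows "prob {\<omega> \<in> space M. b + 2 * r \<le> S n \<omega>}
    \<le> q * prob {\<omega> \<in> space M. \<exists>k\<in>{1..n}. b \<le> D n k \<omega>} + n * prob {\<omega> \<in> space M. r < Xs 0 \<omega>}"
proof -
  have passage: "\<exists>k\<in>{1..n}. first_passage n b k \<omega> \<and> r \<le> S k \<omega>"
    if S: "b + 2 * r \<le> S n \<omega>" and X: "\<forall>k\<in>{1..n}. Xs k \<omega> \<le> r" for \<omega>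
  proof -
    have D_step: "D n k \<omega> = Xs (Suc k) \<omega> + D n (Suc k) \<omega>" if "k < n" for k
    proof -
      have "{k<..n} = insert (Suc k) {Suc k<..n}" using that by auto
      then show ?thesis by (simp add: D_def)
    qed
    have "n \<ge> 1" using S b r by (cases n) (auto simp: S_def)
    \<comment> \<open>Passage is sought among indices from 1 on, so the step \<open>Xs 1\<close>
      missing from \<open>D n 1\<close> must be absorbed by the margin.\<close>
    moreover have "b \<le> D n 1 \<omega>"
    proof -
      have "S n \<omega> = Xs 1 \<omega> + D n 1 \<omega>"
        using S_eq_add_D[OF \<open>n \<ge> 1\<close>, of \<omega>] by (simp add: S_def)
      moreover have "Xs 1 \<omega> \<le> r" using X \<open>n \<ge> 1\<close> by auto
      ultimately show ?thesis using S r by linarith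
    qed
    ultimately obtain k where k: "k \<in> {1..n}" "first_passage n b k \<omega>"
      using first_passage_exists[of n b \<omega>] by auto
    \<comment> \<open>The empty sum \<open>D n n\<close> is below \<open>b > 0\<close>, so there is
      a step with index \<open>Suc k\<close> that crosses the level.\<close>
    have "k < n"
    proof (rule ccontr)
      assume "\<not> k < n"
      with k have "D n k \<omega> = 0" by (simp add: D_def)
      with k b show False by (simp add: first_passage_def)
    qed
    then have "D n (Suc k) \<omega> < b" "Xs (Suc k) \<omega> \<le> r" using k X by (auto simp: first_passage_def)
    then have "D n k \<omega> \<le> b + r" using D_step[OF \<open>k < n\<close>] by linarith
    then have "r \<le> S k \<omega>" using S S_eq_add_D[of k n \<omega>] \<open>k < n\<close> by linarith
    with k show ?thesis by blast
  qed
  have "prob {\<omega> \<in> space M. b + 2 * r \<le> S n \<omega>}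
     \<le> prob ({\<omega> \<in> space M. \<exists>k\<in>{1..n}. first_passage n b k \<omega> \<and> r \<le> S k \<omega>} \<union> (\<Union>k\<in>{1..n}. {\<omega> \<in> space M. r < Xs k \<omega>}))"
    by (rule finite_measure_mono) (use passage in \<open>auto simp: not_less [symmetric]\<close>)
  also have "\<dots> \<le> prob {\<omega> \<in> space M. \<exists>k\<in>{1..n}. first_passage n b k \<omega> \<and> r \<le> S k \<omega>} + prob (\<Union>k\<in>{1..n}. {\<omega> \<in> space M. r < Xs k \<omega>})"
    by (rule measure_Un_le) measurable
  also have "prob (\<Union>k\<in>{1..n}. {\<omega> \<in> space M. r < Xs k \<omega>}) \<le> (\<Sum>k\<in>{1..n}. prob {\<omega> \<in> space M. r < Xs k \<omega>})"
    by (rule measure_UNION_le) auto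
  also have "\<dots> = n * prob {\<omega> \<in> space M. r < Xs 0 \<omega>}"
  proof -
    have "prob {\<omega> \<in> space M. r < Xs k \<omega>} = prob {\<omega> \<in> space M. r < Xs 0 \<omega>}" for k
      using prob_Xs[of "{r<..}" k] by simp
    then have "(\<Sum>k\<in>{1..n}. prob {\<omega> \<in> space M. r < Xs k \<omega>}) = (\<Sum>k\<in>{1..n}. prob {\<omega> \<in> space M. r < Xs 0 \<omega>})"
      by (intro sum.cong refl)
    then show ?thesis by simp
  qed
  also have "prob {\<omega> \<in> space M. \<exists>k\<in>{1..n}. first_passage n b k \<omega> \<and> r \<le> S k \<omega>}
     = (\<Sum>k\<in>{1..n}. prob {\<omega> \<in> space M. first_passage n b k \<omega>} * prob {\<omega> \<in> space M. r \<le> S k \<omega>})"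
    unfolding S_block
    by (subst prob_first_passage) (use S_block_measurable in measurable)
  also have "\<dots> \<le> q * prob {\<omega> \<in> space M. \<exists>k\<in>{1..n}. b \<le> D n k \<omega>}"
    unfolding prob_max_D sum_distrib_left
    by (intro sum_mono) (auto simp: mult.commute[of q] intro: mult_left_mono[OF q] mult_right_mono[OF q])
  finally show ?thesis by simp
qed

text \<open>\<open>D n k\<close> starts with the step \<open>Suc k\<close>, so \<open>Ys k\<close>
  belongs to the block \<open>{1..k}\<close> and is independent of a passage at \<open>k\<close>,
  even if it depends on \<open>Xs k\<close>.\<close>

lemma prob_max_D_Ys_ge:
  "prob {\<omega> \<in> space M. c < Ys 0 \<omega>} * prob {\<omega> \<in> space M. \<exists>k\<in>{1..n}. b \<le> D n k \<omega>}
    \<le> prob {\<omega> \<in> space M. \<exists>k\<in>{1..n}. b \<le> D n k \<omega> \<and> c < Ys k \<omega>}"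
proof -
  \<comment> \<open>The guard \<open>k \<in> {1..k}\<close> only matters for \<open>k = 0\<close>, where \<open>f k\<close> would not be measurable.\<close>
  have [measurable]: "Measurable.pred (PiM {1..k} (\<lambda>_. borel \<Otimes>\<^sub>M borel)) (\<lambda>f. k \<in> {1..k} \<longrightarrow> c < (snd (f k) :: real))" for k :: nat
  proof (cases "k \<in> {1..k}")
    case True
    then have "(\<lambda>f. snd (f k)) \<in> PiM {1..k} (\<lambda>_. borel \<Otimes>\<^sub>M (borel :: real measure)) \<rightarrow>\<^sub>M (borel :: real measure)"
      by (rule measurable_component_snd)
    then show ?thesis by measurable
  qed simp
  have "prob {\<omega> \<in> space M. c < Ys 0 \<omega>} * prob {\<omega> \<in> space M. \<exists>k\<in>{1..n}. b \<le> D n k \<omega>}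
     = (\<Sum>k\<in>{1..n}. prob {\<omega> \<in> space M. first_passage n b k \<omega>} * prob {\<omega> \<in> space M. c < Ys k \<omega>})"
  proof -
    have "prob {\<omega> \<in> space M. c < Ys 0 \<omega>} = prob {\<omega> \<in> space M. c < Ys k \<omega>}" for k
      using prob_Ys[of "{c<..}" k] by simp
    then show ?thesis unfolding prob_max_D sum_distrib_left
      by (intro sum.cong refl) (subst mult.commute, rule arg_cong2[where f = "(*)"], simp_all)
  qed
  also have "\<dots> = (\<Sum>k\<in>{1..n}. prob {\<omega> \<in> space M. first_passage n b k \<omega>}
      * prob {\<omega> \<in> space M. k \<in> {1..k} \<longrightarrow> c < snd ((\<lambda>i\<in>{1..k}. (Xs i \<omega>, Ys i \<omega>)) k)})"
    by (intro sum.cong) auto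
  also have "\<dots> = prob {\<omega> \<in> space M. \<exists>k\<in>{1..n}. first_passage n b k \<omega> \<and> (k \<in> {1..k} \<longrightarrow> c < snd ((\<lambda>i\<in>{1..k}. (Xs i \<omega>, Ys i \<omega>)) k))}"
    by (rule prob_first_passage[where Q = "\<lambda>k f. k \<in> {1..k} \<longrightarrow> c < snd (f k)", symmetric]) measurable
  also have "\<dots> \<le> prob {\<omega> \<in> space M. \<exists>k\<in>{1..n}. b \<le> D n k \<omega> \<and> c < Ys k \<omega>}"
    by (rule finite_measure_mono) (auto simp: first_passage_def)
  finally show ?thesis .
qed

subsection \<open>The central limit theorem and the normal limit\<close>

text \<open>The central limit theorem sums from index 0 and the walk from 1, hence the shift.
  Restricting to the singleton blocks \<open>{Suc j}\<close> reindexes the family.\<close>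

lemma indep_Xs: "indep_vars (\<lambda>_. borel) (\<lambda>i. Xs (Suc i)) UNIV"
proof -
  have "indep_vars (\<lambda>j. PiM {Suc j} (\<lambda>_. borel \<Otimes>\<^sub>M borel)) (\<lambda>j \<omega>. \<lambda>i\<in>{Suc j}. (Xs i \<omega>, Ys i \<omega>)) UNIV"
    by (rule indep_vars_restrict[OF indep]) (auto simp: disjoint_family_on_def)
  from indep_vars_compose2[OF this, of "\<lambda>j f. fst (f (Suc j))" "\<lambda>_. borel"]
  show ?thesis by (simp add: measurable_component_fst)
qed

lemma indep_Ys: "indep_vars (\<lambda>_. borel) Ys UNIV"
  using indep_vars_compose2[OF indep, of "\<lambda>_. snd" "\<lambda>_. borel"] by simp

text \<open>The central limit theorem evaluated on \<open>{t..}\<close>, whose frontier is a null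
  set. The tail is closed to match the condition \<open>b \<le> D n k \<omega>\<close> in a
  passage.\<close>

lemma S_tail_tendsto:
  "(\<lambda>n. prob {\<omega> \<in> space M. t * (v * sqrt (real n)) \<le> S n \<omega>}) \<longlonglongrightarrow> 1 - cdf std_normal_distribution t"
proof -
  have XX: "expectation (\<lambda>\<omega>. f (Xs k \<omega>)) = expectation (\<lambda>\<omega>. f (Xs 0 \<omega>))"
    "integrable M (\<lambda>\<omega>. f (Xs k \<omega>)) \<longleftrightarrow> integrable M (\<lambda>\<omega>. f (Xs 0 \<omega>))"
    if [measurable]: "f \<in> borel_measurable borel" for f :: "real \<Rightarrow> real" and k
    using integral_distr[of "Xs k" M borel f] integral_distr[of "Xs 0" M borel f]
      integrable_distr_eq[of "Xs k" M borel f] integrable_distr_eq[of "Xs 0" M borel f] distr_Xs[of k]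
    by auto
  have mean': "expectation (Xs k) = 0" for k
    using XX(1)[of "\<lambda>x. x" k] mean by simp
  have var': "variance (Xs k) = v\<^sup>2" for k
    using XX(1)[of "\<lambda>x. x\<^sup>2" k] mean' var by simp
  have clt: "weak_conv_m (\<lambda>n. distr M borel (\<lambda>x. (\<Sum>i<n. Xs (Suc i) x) / sqrt (n * v\<^sup>2))) std_normal_distribution"
  proof (rule central_limit_theorem_zero_mean[OF indep_Xs])
    show "integrable M (\<lambda>x. (Xs (Suc n) x)\<^sup>2)" for n
      using XX(2)[of "\<lambda>x. x\<^sup>2" "Suc n"] square_integrable by simp
    show "distr M borel (Xs (Suc n)) = distr M borel (Xs 0)" for n
      by (rule distr_Xs)
  qed (fact mean' var' v_pos)+
  have "(\<lambda>n. measure (distr M borel (\<lambda>x. (\<Sum>i<n. Xs (Suc i) x) / sqrt (n * v\<^sup>2))) {t..})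
      \<longlonglongrightarrow> measure std_normal_distribution {t..}"
  proof (rule weak_conv_imp_continuity_set_conv[OF _ real_dist_normal_dist clt])
    show "real_distribution (distr M borel (\<lambda>x. (\<Sum>i<n. Xs (Suc i) x) / sqrt (n * v\<^sup>2)))" for n :: nat
      by (rule real_distribution_distr) measurable
    have "frontier {t..} = {t}" by (auto simp: frontier_def)
    then show "emeasure std_normal_distribution (frontier {t..}) = 0"
      by (simp add: std_normal_emeasure_singleton)
  qed simp
  moreover have "\<forall>\<^sub>F n in sequentially. measure (distr M borel (\<lambda>x. (\<Sum>i<n. Xs (Suc i) x) / sqrt (n * v\<^sup>2))) {t..}
      = prob {\<omega> \<in> space M. t * (v * sqrt (real n)) \<le> S n \<omega>}"
    using eventually_gt_at_top[of 0]
  proof eventually_elim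
    case (elim n)
    then have "v * sqrt (real n) > 0" using v_pos by simp
    then have "t \<le> (\<Sum>i<n. Xs (Suc i) \<omega>) / sqrt (n * v\<^sup>2) \<longleftrightarrow> t * (v * sqrt (real n)) \<le> S n \<omega>" for \<omega>
      using v_pos by (simp add: S_def sum.atLeast1_atMost_eq real_sqrt_mult pos_le_divide_eq mult.commute)
    then show ?case
      by (simp add: measure_distr vimage_def Int_def conj_commute)
  qed
  ultimately show ?thesis
    unfolding std_normal_measure_atLeast by (rule Lim_transform_eventually)
qed

text \<open>Uniformity in \<open>m\<close> matters since the passage index can be any
  \<open>k \<le> n\<close>. For large \<open>m\<close> the limit 1/2 of the probability of
  \<open>0 \<le> S m\<close> suffices; for the finitely many others a large \<open>r\<close>
  does.\<close>

lemma eventually_S_median: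
  assumes "e > 0"
  shows "\<forall>\<^sub>F r in at_top. \<forall>m. prob {\<omega> \<in> space M. r \<le> S m \<omega>} \<le> 1/2 + e \<and> 1/2 - e \<le> prob {\<omega> \<in> space M. - r \<le> S m \<omega>}"
proof -
  have "(\<lambda>n. prob {\<omega> \<in> space M. 0 \<le> S n \<omega>}) \<longlonglongrightarrow> 1/2"
    using S_tail_tendsto[of 0] by (simp add: std_normal_cdf_0)
  from tendstoD[OF this assms] obtain m0 where m0:
    "\<And>m. m \<ge> m0 \<Longrightarrow> \<bar>prob {\<omega> \<in> space M. 0 \<le> S m \<omega>} - 1/2\<bar> < e"
    by (auto simp: eventually_sequentially dist_real_def)
  have "\<forall>\<^sub>F r in at_top. \<forall>m\<in>{..<m0}. prob {\<omega> \<in> space M. r \<le> S m \<omega>} < 1/2 \<and> 1/2 < prob {\<omega> \<in> space M. - r \<le> S m \<omega>}"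
  proof (rule eventually_ball_finite, simp, safe)
    fix m
    interpret L: real_distribution "distr M borel (S m)" by simp
    have "\<forall>\<^sub>F r in at_top. 1/2 < cdf (distr M borel (S m)) r"
      using order_tendstoD(1)[OF L.cdf_lim_at_top_prob, of "1/2"] by simp
    then have 1: "\<forall>\<^sub>F r in at_top. 1/2 < prob {\<omega> \<in> space M. S m \<omega> \<le> r}"
      by (simp add: cdf_def measure_distr vimage_def Int_def conj_commute)
    \<comment> \<open>The shift by 1 makes \<open>S m \<omega> \<le> r - 1\<close> incompatible with
      the closed condition \<open>r \<le> S m \<omega>\<close>.\<close>
    then have 1: "\<forall>\<^sub>F r in at_top. 1/2 < prob {\<omega> \<in> space M. S m \<omega> \<le> r - 1}"
      using filterlim_tendsto_add_at_top[OF tendsto_const[of "-1"] filterlim_ident]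
      by (auto simp: filterlim_iff elim!: allE[where x = "\<lambda>r. 1/2 < prob {\<omega> \<in> space M. S m \<omega> \<le> r}"])
    have "\<forall>\<^sub>F r in at_bot. cdf (distr M borel (S m)) r < 1/2"
      using order_tendstoD(2)[OF L.cdf_lim_at_bot, of "1/2"] by simp
    then have 2: "\<forall>\<^sub>F r in at_top. prob {\<omega> \<in> space M. S m \<omega> \<le> - r} < 1/2"
      by (simp add: cdf_def measure_distr vimage_def Int_def conj_commute at_bot_mirror eventually_filtermap)
    show "\<forall>\<^sub>F r in at_top. prob {\<omega> \<in> space M. r \<le> S m \<omega>} < 1/2 \<and> 1/2 < prob {\<omega> \<in> space M. - r \<le> S m \<omega>}"
      using 1 2
    proof eventually_elim
      case (elim r)
      have "prob {\<omega> \<in> space M. r \<le> S m \<omega>} \<le> prob (space M - {\<omega> \<in> space M. S m \<omega> \<le> r - 1})"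
        by (rule finite_measure_mono) auto
      also have "\<dots> = 1 - prob {\<omega> \<in> space M. S m \<omega> \<le> r - 1}"
        by (rule prob_compl) measurable
      finally have a: "prob {\<omega> \<in> space M. r \<le> S m \<omega>} < 1/2" using elim by linarith
      have "1 - prob {\<omega> \<in> space M. S m \<omega> \<le> - r} = prob (space M - {\<omega> \<in> space M. S m \<omega> \<le> - r})"
        by (rule prob_compl[symmetric]) measurable
      also have "\<dots> \<le> prob {\<omega> \<in> space M. - r \<le> S m \<omega>}"
        by (rule finite_measure_mono) auto
      finally show ?case using a elim by linarith
    qed
  qed
  with eventually_ge_at_top[of 0] show ?thesis
  proof eventually_elim
    case (elim r)
    show ?case
    proof
      fix m
      show "prob {\<omega> \<in> space M. r \<le> S m \<omega>} \<le> 1/2 + e \<and> 1/2 - e \<le> prob {\<omega> \<in> space M. - r \<le> S m \<omega>}"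
      proof (cases "m < m0")
        case True
        then show ?thesis using elim assms by (force intro: less_imp_le)
      next
        case False
        have "prob {\<omega> \<in> space M. r \<le> S m \<omega>} \<le> prob {\<omega> \<in> space M. 0 \<le> S m \<omega>}"
          by (rule finite_measure_mono) (use elim in auto)
        moreover have "prob {\<omega> \<in> space M. 0 \<le> S m \<omega>} \<le> prob {\<omega> \<in> space M. - r \<le> S m \<omega>}"
          by (rule finite_measure_mono) (use elim in auto)
        ultimately show ?thesis using m0[of m] False by linarith
      qed
    qed
  qed
qed

lemma scale_at_top: "d > 0 \<Longrightarrow> filterlim (\<lambda>n. d * (v * sqrt (real n))) at_top sequentially"
  by (intro filterlim_tendsto_pos_mult_at_top[OF tendsto_const] v_pos
      filterlim_compose[OF sqrt_at_top] filterlim_real_sequentially)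

text \<open>With \<open>t = d * (v * sqrt n)\<close>, the factor \<open>n\<close> is
  \<open>t\<^sup>2\<close> divided by \<open>(d * v)\<^sup>2\<close>. This makes union bounds over
  \<open>n\<close> variables negligible.\<close>

lemma n_tail_tendsto:
  assumes "((\<lambda>t. t\<^sup>2 * g t) \<longlongrightarrow> 0) at_top" and d: "d > 0"
  shows "(\<lambda>n. real n * g (d * (v * sqrt (real n)))) \<longlonglongrightarrow> 0"
proof -
  have "(\<lambda>n. (1 / (d * v)\<^sup>2) * ((d * (v * sqrt (real n)))\<^sup>2 * g (d * (v * sqrt (real n))))) \<longlonglongrightarrow> (1 / (d * v)\<^sup>2) * 0"
    by (intro tendsto_mult tendsto_const filterlim_compose[OF assms(1) scale_at_top[OF d]])
  moreover have "(1 / (d * v)\<^sup>2) * (d * (v * sqrt (real n)))\<^sup>2 = real n" for n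
    using d v_pos by (simp add: power_mult_distrib field_simps)
  then have "(1 / (d * v)\<^sup>2) * ((d * (v * sqrt (real n)))\<^sup>2 * x) = real n * x" for n x
    by (metis mult.assoc)
  ultimately show ?thesis by simp
qed

text \<open>The two reflection bounds are used with \<open>r = d * (v * sqrt n)\<close> and
  \<open>q = 1/2 - d\<close> or \<open>q = 1/2 + d\<close>. Both then tend to explicit normal tails,
  and continuity of the cdf lets \<open>d\<close> tend to 0.\<close>

lemma max_D_tendsto:
  assumes a: "a > 0" and tail: "((\<lambda>t. t\<^sup>2 * prob {\<omega> \<in> space M. t < Xs 0 \<omega>}) \<longlongrightarrow> 0) at_top"
  shows "(\<lambda>n. prob {\<omega> \<in> space M. \<exists>k\<in>{1..n}. a * (v * sqrt (real n)) \<le> D n k \<omega>})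
    \<longlonglongrightarrow> 2 * (1 - cdf std_normal_distribution a)"
proof (rule order_tendstoI)
  let ?\<Phi> = "cdf std_normal_distribution"
  have cont: "isCont ?\<Phi> x" for x by (rule isCont_std_normal_cdf)
  fix u assume u: "2 * (1 - ?\<Phi> a) < u"
  have "((\<lambda>d. (1 - ?\<Phi> (a - d)) / (1/2 - d)) \<longlongrightarrow> (1 - ?\<Phi> (a - 0)) / (1/2 - 0)) (at_right 0)"
    by (intro tendsto_intros isCont_tendsto_compose[OF cont]) auto
  then have "\<forall>\<^sub>F d in at_right 0. (1 - ?\<Phi> (a - d)) / (1/2 - d) < u"
    using u by (intro order_tendstoD(2)) (auto simp: field_simps)
  then obtain d where d: "0 < d" "d < 1/2" "(1 - ?\<Phi> (a - d)) / (1/2 - d) < u"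
    using eventually_at_right_0E[of _ "1/2"] by auto
  have "(\<lambda>n. prob {\<omega> \<in> space M. (a - d) * (v * sqrt (real n)) \<le> S n \<omega>} / (1/2 - d)) \<longlonglongrightarrow> (1 - ?\<Phi> (a - d)) / (1/2 - d)"
    using d by (intro tendsto_divide S_tail_tendsto tendsto_const) auto
  from order_tendstoD(2)[OF this d(3)] have lt: "\<forall>\<^sub>F n in sequentially. prob {\<omega> \<in> space M. (a - d) * (v * sqrt (real n)) \<le> S n \<omega>} / (1/2 - d) < u" .
  have med: "\<forall>\<^sub>F n in sequentially. \<forall>m. 1/2 - d \<le> prob {\<omega> \<in> space M. - (d * (v * sqrt (real n))) \<le> S m \<omega>}"
    using eventually_compose_filterlim[OF eventually_S_median[OF d(1)] scale_at_top[OF d(1)]]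
    by eventually_elim auto
  show "\<forall>\<^sub>F n in sequentially. prob {\<omega> \<in> space M. \<exists>k\<in>{1..n}. a * (v * sqrt (real n)) \<le> D n k \<omega>} < u"
    using lt med
  proof eventually_elim
    case (elim n)
    then have "(1/2 - d) * prob {\<omega> \<in> space M. \<exists>k\<in>{1..n}. a * (v * sqrt (real n)) \<le> D n k \<omega>}
       \<le> prob {\<omega> \<in> space M. a * (v * sqrt (real n)) - d * (v * sqrt (real n)) \<le> S n \<omega>}"
      by (intro prob_max_D_le) auto
    then have "prob {\<omega> \<in> space M. \<exists>k\<in>{1..n}. a * (v * sqrt (real n)) \<le> D n k \<omega>}
       \<le> prob {\<omega> \<in> space M. (a - d) * (v * sqrt (real n)) \<le> S n \<omega>} / (1/2 - d)"
      using d by (simp add: pos_le_divide_eq left_diff_distrib mult.commute)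
    then show ?case using elim by linarith
  qed
next
  let ?\<Phi> = "cdf std_normal_distribution"
  have cont: "isCont ?\<Phi> x" for x by (rule isCont_std_normal_cdf)
  fix l assume l: "l < 2 * (1 - ?\<Phi> a)"
  have "((\<lambda>d. (1 - ?\<Phi> (a + 2 * d)) / (1/2 + d)) \<longlongrightarrow> (1 - ?\<Phi> (a + 2 * 0)) / (1/2 + 0)) (at_right 0)"
    by (intro tendsto_intros isCont_tendsto_compose[OF cont]) auto
  then have "\<forall>\<^sub>F d in at_right 0. l < (1 - ?\<Phi> (a + 2 * d)) / (1/2 + d)"
    using l by (intro order_tendstoD(1)) (auto simp: field_simps)
  then obtain d where d: "0 < d" "l < (1 - ?\<Phi> (a + 2 * d)) / (1/2 + d)"
    using eventually_at_right_0E[of _ "1/2"] by auto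
  have "(\<lambda>n. (prob {\<omega> \<in> space M. (a + 2 * d) * (v * sqrt (real n)) \<le> S n \<omega>}
      - real n * prob {\<omega> \<in> space M. d * (v * sqrt (real n)) < Xs 0 \<omega>}) / (1/2 + d)) \<longlonglongrightarrow> ((1 - ?\<Phi> (a + 2 * d)) - 0) / (1/2 + d)"
    using d by (intro tendsto_divide tendsto_diff S_tail_tendsto tendsto_const n_tail_tendsto[OF tail]) auto
  then have lt: "\<forall>\<^sub>F n in sequentially. l < (prob {\<omega> \<in> space M. (a + 2 * d) * (v * sqrt (real n)) \<le> S n \<omega>}
      - real n * prob {\<omega> \<in> space M. d * (v * sqrt (real n)) < Xs 0 \<omega>}) / (1/2 + d)"
    using d(2) by (intro order_tendstoD(1)) auto
  have med: "\<forall>\<^sub>F n in sequentially. \<forall>m. prob {\<omega> \<in> space M. d * (v * sqrt (real n)) \<le> S m \<omega>} \<le> 1/2 + d"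
    using eventually_compose_filterlim[OF eventually_S_median[OF d(1)] scale_at_top[OF d(1)]]
    by eventually_elim auto
  show "\<forall>\<^sub>F n in sequentially. l < prob {\<omega> \<in> space M. \<exists>k\<in>{1..n}. a * (v * sqrt (real n)) \<le> D n k \<omega>}"
    using lt med eventually_gt_at_top[of 0]
  proof eventually_elim
    case (elim n)
    then have "prob {\<omega> \<in> space M. a * (v * sqrt (real n)) + 2 * (d * (v * sqrt (real n))) \<le> S n \<omega>}
       \<le> (1/2 + d) * prob {\<omega> \<in> space M. \<exists>k\<in>{1..n}. a * (v * sqrt (real n)) \<le> D n k \<omega>}
          + n * prob {\<omega> \<in> space M. d * (v * sqrt (real n)) < Xs 0 \<omega>}"
      using elim a d v_pos by (intro prob_max_D_ge mult_pos_pos) auto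
    moreover have "a * (v * sqrt (real n)) + 2 * (d * (v * sqrt (real n))) = (a + 2 * d) * (v * sqrt (real n))"
      by (simp add: algebra_simps)
    moreover have "(A - B) / q \<le> p" if "A \<le> q * p + B" "q > 0" for A B p q :: real
      using that by (simp add: pos_divide_le_eq mult.commute)
    ultimately have "(prob {\<omega> \<in> space M. (a + 2 * d) * (v * sqrt (real n)) \<le> S n \<omega>}
         - real n * prob {\<omega> \<in> space M. d * (v * sqrt (real n)) < Xs 0 \<omega>}) / (1/2 + d)
       \<le> prob {\<omega> \<in> space M. \<exists>k\<in>{1..n}. a * (v * sqrt (real n)) \<le> D n k \<omega>}"
      using d by simp
    then show ?case using elim by linarith
  qed
qed

lemma prob_ex_Ys_le:
  "prob {\<omega> \<in> space M. \<exists>k\<in>{1..n}. t < Ys k \<omega>} \<le> n * prob {\<omega> \<in> space M. t < Ys 0 \<omega>}"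
proof -
  have "{\<omega> \<in> space M. \<exists>k\<in>{1..n}. t < Ys k \<omega>} = (\<Union>k\<in>{1..n}. {\<omega> \<in> space M. t < Ys k \<omega>})"
    by auto
  also have "prob \<dots> \<le> (\<Sum>k\<in>{1..n}. prob {\<omega> \<in> space M. t < Ys k \<omega>})"
    by (rule measure_UNION_le) auto
  also have "\<dots> = (\<Sum>k\<in>{1..n}. prob {\<omega> \<in> space M. t < Ys 0 \<omega>})"
  proof (rule sum.cong[OF refl])
    show "prob {\<omega> \<in> space M. t < Ys k \<omega>} = prob {\<omega> \<in> space M. t < Ys 0 \<omega>}" for k
      using prob_Ys[of "{t<..}" k] by simp
  qed
  finally show ?thesis by simp
qed

lemma ln_perp_R_normal_limit:
  assumes y: "y > 0"
    and tail_X: "((\<lambda>t. t\<^sup>2 * prob {\<omega> \<in> space M. t < Xs 0 \<omega>}) \<longlongrightarrow> 0) at_top"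
    and tail_Y: "((\<lambda>t. t\<^sup>2 * prob {\<omega> \<in> space M. t < Ys 0 \<omega>}) \<longlongrightarrow> 0) at_top"
  shows "(\<lambda>n. prob {\<omega> \<in> space M. ln (perp_R Xs Ys n \<omega>) \<le> y * (v * sqrt (real n))}) \<longlonglongrightarrow> abs_normal_cdf y"
proof -
  let ?\<Phi> = "cdf std_normal_distribution"
  let ?c = "\<lambda>n. v * sqrt (real n)"
  let ?p = "\<lambda>a n. prob {\<omega> \<in> space M. \<exists>k\<in>{1..n}. a * ?c n \<le> D n k \<omega>}"
  let ?r = "\<lambda>n. prob {\<omega> \<in> space M. y * ?c n < ln (perp_R Xs Ys n \<omega>)}"
  note cont = isCont_std_normal_cdf
  have "?r \<longlonglongrightarrow> 2 * (1 - ?\<Phi> y)"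
  proof (rule order_tendstoI)
    fix u assume u: "2 * (1 - ?\<Phi> y) < u"
    \<comment> \<open>One \<open>d\<close> is spent on the largest \<open>Ys k\<close>, the other on
      the error \<open>ln n\<close>.\<close>
    have "((\<lambda>d. 2 * (1 - ?\<Phi> (y - 2 * d))) \<longlongrightarrow> 2 * (1 - ?\<Phi> (y - 2 * 0))) (at_right 0)"
      by (intro tendsto_intros isCont_tendsto_compose[OF cont])
    then have "\<forall>\<^sub>F d in at_right 0. 2 * (1 - ?\<Phi> (y - 2 * d)) < u"
      using u by (intro order_tendstoD(2)) auto
    then obtain d where d: "0 < d" "d < y / 2" "2 * (1 - ?\<Phi> (y - 2 * d)) < u"
      using eventually_at_right_0E[of _ "y / 2"] y by auto
    have "(\<lambda>n. ?p (y - 2 * d) n + real n * prob {\<omega> \<in> space M. d * ?c n < Ys 0 \<omega>}) \<longlonglongrightarrow> 2 * (1 - ?\<Phi> (y - 2 * d)) + 0"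
      using d by (intro tendsto_add max_D_tendsto n_tail_tendsto tail_X tail_Y) auto
    then have lt: "\<forall>\<^sub>F n in sequentially. ?p (y - 2 * d) n + real n * prob {\<omega> \<in> space M. d * ?c n < Ys 0 \<omega>} < u"
      using d(3) by (intro order_tendstoD(2)) auto
    have ln: "\<forall>\<^sub>F n in sequentially. ln (real n) \<le> d * ?c n"
      using d(1) v_pos by real_asymp
    show "\<forall>\<^sub>F n in sequentially. ?r n < u"
      using lt ln eventually_gt_at_top[of 0]
    proof eventually_elim
      case (elim n)
      have sub: "y * ?c n \<ge> ln (perp_R Xs Ys n \<omega>)"
        if "\<forall>k\<in>{1..n}. D n k \<omega> < (y - 2 * d) * ?c n" "\<forall>k\<in>{1..n}. Ys k \<omega> \<le> d * ?c n" for \<omega>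
      proof -
        have "Ys k \<omega> + D n k \<omega> \<le> (y - d) * ?c n" if "k \<in> {1..n}" for k
          using \<open>\<forall>k\<in>{1..n}. D n k \<omega> < _\<close> \<open>\<forall>k\<in>{1..n}. Ys k \<omega> \<le> _\<close> that
          by (force simp: algebra_simps)
        then have "ln (perp_R Xs Ys n \<omega>) \<le> ln (real n) + (y - d) * ?c n"
          using elim by (intro ln_perp_R_le) auto
        also have "\<dots> \<le> y * ?c n" using elim by (simp add: algebra_simps)
        finally show ?thesis .
      qed
      have "?r n \<le> prob ({\<omega> \<in> space M. \<exists>k\<in>{1..n}. (y - 2 * d) * ?c n \<le> D n k \<omega>} \<union> {\<omega> \<in> space M. \<exists>k\<in>{1..n}. d * ?c n < Ys k \<omega>})"
        by (rule finite_measure_mono) (use sub in \<open>force simp: not_le[symmetric]\<close>, measurable)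
      also have "\<dots> \<le> ?p (y - 2 * d) n + prob {\<omega> \<in> space M. \<exists>k\<in>{1..n}. d * ?c n < Ys k \<omega>}"
        by (rule measure_Un_le) measurable
      also have "\<dots> \<le> ?p (y - 2 * d) n + real n * prob {\<omega> \<in> space M. d * ?c n < Ys 0 \<omega>}"
        using prob_ex_Ys_le by simp
      finally show ?case using elim by linarith
    qed
  next
    fix l assume l: "l < 2 * (1 - ?\<Phi> y)"
    \<comment> \<open>The single \<open>d\<close> pays for a negative \<open>Ys k\<close> at the
      passage index; a lower bound for the sum involves no \<open>ln n\<close>.\<close>
    have "((\<lambda>d. 2 * (1 - ?\<Phi> (y + d))) \<longlongrightarrow> 2 * (1 - ?\<Phi> (y + 0))) (at_right 0)"
      by (intro tendsto_intros isCont_tendsto_compose[OF cont])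
    then have "\<forall>\<^sub>F d in at_right 0. l < 2 * (1 - ?\<Phi> (y + d))"
      using l by (intro order_tendstoD(1)) auto
    then obtain d where d: "0 < d" "l < 2 * (1 - ?\<Phi> (y + d))"
      using eventually_at_right_0E[of _ 1] by auto
    \<comment> \<open>The threshold tends to minus infinity, so the limit of the cdf at
      \<open>at_bot\<close> is all that enters.\<close>
    have Y: "(\<lambda>n. prob {\<omega> \<in> space M. - (d * ?c n) < Ys 0 \<omega>}) \<longlonglongrightarrow> 1"
    proof -
      interpret L: real_distribution "distr M borel (Ys 0)" by simp
      have "(\<lambda>n. cdf (distr M borel (Ys 0)) (- (d * ?c n))) \<longlonglongrightarrow> 0"
        by (rule filterlim_compose[OF L.cdf_lim_at_bot filterlim_compose[OF filterlim_uminus_at_bot_at_top scale_at_top[OF d(1)]]])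
      then have "(\<lambda>n. 1 - cdf (distr M borel (Ys 0)) (- (d * ?c n))) \<longlonglongrightarrow> 1 - 0"
        by (intro tendsto_diff tendsto_const)
      moreover have "1 - cdf (distr M borel (Ys 0)) t = prob {\<omega> \<in> space M. t < Ys 0 \<omega>}" for t
      proof -
        have "prob {\<omega> \<in> space M. t < Ys 0 \<omega>} = prob (space M - {\<omega> \<in> space M. Ys 0 \<omega> \<le> t})"
          by (rule arg_cong[where f = prob]) auto
        also have "\<dots> = 1 - prob {\<omega> \<in> space M. Ys 0 \<omega> \<le> t}" by (rule prob_compl) measurable
        finally show ?thesis by (simp add: cdf_def measure_distr vimage_def Int_def conj_commute)
      qed
      ultimately show ?thesis by simp
    qed
    have "(\<lambda>n. prob {\<omega> \<in> space M. - (d * ?c n) < Ys 0 \<omega>} * ?p (y + d) n) \<longlonglongrightarrow> 1 * (2 * (1 - ?\<Phi> (y + d)))"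
      using d y by (intro tendsto_mult Y max_D_tendsto tail_X) auto
    then have lt: "\<forall>\<^sub>F n in sequentially. l < prob {\<omega> \<in> space M. - (d * ?c n) < Ys 0 \<omega>} * ?p (y + d) n"
      using d(2) by (intro order_tendstoD(1)) auto
    show "\<forall>\<^sub>F n in sequentially. l < ?r n"
      using lt
    proof eventually_elim
      case (elim n)
      have "prob {\<omega> \<in> space M. - (d * ?c n) < Ys 0 \<omega>} * ?p (y + d) n
          \<le> prob {\<omega> \<in> space M. \<exists>k\<in>{1..n}. (y + d) * ?c n \<le> D n k \<omega> \<and> - (d * ?c n) < Ys k \<omega>}"
        by (rule prob_max_D_Ys_ge)
      also have "\<dots> \<le> ?r n"
      proof (rule finite_measure_mono)
        have "y * ?c n < ln (perp_R Xs Ys n \<omega>)"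
          if "k \<in> {1..n}" "(y + d) * ?c n \<le> D n k \<omega>" "- (d * ?c n) < Ys k \<omega>" for k \<omega>
          using ln_perp_R_ge[OF that(1), of \<omega>] that(2,3) by (simp add: algebra_simps)
        then show "{\<omega> \<in> space M. \<exists>k\<in>{1..n}. (y + d) * ?c n \<le> D n k \<omega> \<and> - (d * ?c n) < Ys k \<omega>}
            \<subseteq> {\<omega> \<in> space M. y * ?c n < ln (perp_R Xs Ys n \<omega>)}" by blast
      qed measurable
      finally show ?case using elim by linarith
    qed
  qed
  then have "(\<lambda>n. 1 - ?r n) \<longlonglongrightarrow> 1 - 2 * (1 - ?\<Phi> y)"
    by (intro tendsto_diff tendsto_const)
  moreover have "1 - ?r n = prob {\<omega> \<in> space M. ln (perp_R Xs Ys n \<omega>) \<le> y * ?c n}" for n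
  proof -
    have "1 - ?r n = prob (space M - {\<omega> \<in> space M. y * ?c n < ln (perp_R Xs Ys n \<omega>)})"
      by (rule prob_compl[symmetric]) measurable
    also have "\<dots> = prob {\<omega> \<in> space M. ln (perp_R Xs Ys n \<omega>) \<le> y * ?c n}"
      by (rule arg_cong[where f = prob]) auto
    finally show ?thesis .
  qed
  ultimately show ?thesis using y by (simp add: abs_normal_cdf_eq)
qed

subsection \<open>The heavy-tailed case\<close>

text \<open>The reflected walk satisfies the same assumptions, so a bound on the maximum of
  \<open>D\<close> is also one on its minimum.\<close>

lemma perpetuity_uminus: "perpetuity M (\<lambda>k \<omega>. - Xs k \<omega>) Ys v"
proof
  let ?f = "\<lambda>(x, y). (- x, y) :: real \<times> real"
  have [measurable]: "?f \<in> borel \<Otimes>\<^sub>M borel \<rightarrow>\<^sub>M borel \<Otimes>\<^sub>M borel" by measurable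
  show "indep_vars (\<lambda>_. borel \<Otimes>\<^sub>M borel) (\<lambda>k \<omega>. (- Xs k \<omega>, Ys k \<omega>)) UNIV"
    using indep_vars_compose2[OF indep, of "\<lambda>_. ?f" "\<lambda>_. borel \<Otimes>\<^sub>M borel"] by simp
  have "distr M (borel \<Otimes>\<^sub>M borel) (\<lambda>\<omega>. (- Xs i \<omega>, Ys i \<omega>))
      = distr (distr M (borel \<Otimes>\<^sub>M borel) (\<lambda>\<omega>. (Xs i \<omega>, Ys i \<omega>))) (borel \<Otimes>\<^sub>M borel) ?f" for i
    by (subst distr_distr) (auto simp: comp_def pair_measurable)
  then show "distr M (borel \<Otimes>\<^sub>M borel) (\<lambda>\<omega>. (- Xs k \<omega>, Ys k \<omega>))
      = distr M (borel \<Otimes>\<^sub>M borel) (\<lambda>\<omega>. (- Xs 0 \<omega>, Ys 0 \<omega>))" for k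
    by (metis ident)
qed (use mean square_integrable v_pos var in auto)

text \<open>\<open>prob_max_D_le\<close> with \<open>r = d / 2 * c n\<close> leaves the threshold
  \<open>d / 2 * c n\<close> for \<open>S n\<close>, which eventually exceeds any multiple
  \<open>t\<close> of the standard deviation.\<close>

lemma max_D_negligible:
  assumes c: "\<forall>\<^sub>F n in sequentially. 0 < c n" and slow: "(\<lambda>n. sqrt (real n) / c n) \<longlonglongrightarrow> 0" and d: "d > 0"
  shows "(\<lambda>n. prob {\<omega> \<in> space M. \<exists>k\<in>{1..n}. d * c n \<le> D n k \<omega>}) \<longlonglongrightarrow> 0"
proof (rule order_tendstoI)
  fix u :: real assume u: "0 < u"
  interpret N: real_distribution std_normal_distribution by (rule real_dist_normal_dist)
  have "\<forall>\<^sub>F t in at_top. 1 - u / 4 < cdf std_normal_distribution t"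
    using order_tendstoD(1)[OF N.cdf_lim_at_top_prob, of "1 - u / 4"] u by simp
  with eventually_gt_at_top[of 0] have "\<forall>\<^sub>F t in at_top. 0 < t \<and> 1 - u / 4 < cdf std_normal_distribution t"
    by (rule eventually_conj)
  then obtain t where t: "0 < t" "1 - cdf std_normal_distribution t < u / 4"
    by (force simp: eventually_at_top_linorder)
  have tail: "\<forall>\<^sub>F n in sequentially. prob {\<omega> \<in> space M. t * (v * sqrt (real n)) \<le> S n \<omega>} < u / 4"
    by (rule order_tendstoD(2)[OF S_tail_tendsto t(2)])
  have ratio: "\<forall>\<^sub>F n in sequentially. t * (v * sqrt (real n)) \<le> d / 2 * c n"
  proof -
    have "\<forall>\<^sub>F n in sequentially. sqrt (real n) / c n < d / 2 / (t * v)"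
      using order_tendstoD(2)[OF slow, of "d / 2 / (t * v)"] d t(1) v_pos by simp
    with c show ?thesis
    proof eventually_elim
      case (elim n)
      have "t * v > 0" using t(1) v_pos by simp
      then show ?case using elim by (simp add: field_simps)
    qed
  qed
  have top: "filterlim (\<lambda>n. d / 2 * c n) at_top sequentially"
    by (rule filterlim_at_top_mono[OF scale_at_top[OF t(1)] ratio])
  \<comment> \<open>The value 1/4 is \<open>1/2 - e\<close> at \<open>e = 1/4\<close>; it turns the
    tail bound \<open>u / 4\<close> into \<open>u\<close>.\<close>
  have med: "\<forall>\<^sub>F n in sequentially. \<forall>m. 1/4 \<le> prob {\<omega> \<in> space M. - (d / 2 * c n) \<le> S m \<omega>}"
  proof -
    have "0 < (1/4::real)" by simp
    from eventually_compose_filterlim[OF eventually_S_median[OF this] top] show ?thesis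
      by eventually_elim auto
  qed
  show "\<forall>\<^sub>F n in sequentially. prob {\<omega> \<in> space M. \<exists>k\<in>{1..n}. d * c n \<le> D n k \<omega>} < u"
    using tail ratio med
  proof eventually_elim
    case (elim n)
    have "1/4 * prob {\<omega> \<in> space M. \<exists>k\<in>{1..n}. d * c n \<le> D n k \<omega>} \<le> prob {\<omega> \<in> space M. d * c n - d / 2 * c n \<le> S n \<omega>}"
      using elim by (intro prob_max_D_le) auto
    also have "\<dots> \<le> prob {\<omega> \<in> space M. t * (v * sqrt (real n)) \<le> S n \<omega>}"
      by (rule finite_measure_mono) (use elim in auto)
    finally show ?case using elim by linarith
  qed
next
  fix l :: real assume "l < 0"
  then show "\<forall>\<^sub>F n in sequentially. l < prob {\<omega> \<in> space M. \<exists>k\<in>{1..n}. d * c n \<le> D n k \<omega>}"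
    by (intro always_eventually allI) (rule less_le_trans[OF _ measure_nonneg])
qed

lemma min_D_negligible:
  assumes c: "\<forall>\<^sub>F n in sequentially. 0 < c n" and slow: "(\<lambda>n. sqrt (real n) / c n) \<longlonglongrightarrow> 0" and d: "d > 0"
  shows "(\<lambda>n. prob {\<omega> \<in> space M. \<exists>k\<in>{1..n}. D n k \<omega> \<le> - (d * c n)}) \<longlonglongrightarrow> 0"
proof -
  interpret neg: perpetuity M "\<lambda>k \<omega>. - Xs k \<omega>" Ys v by (rule perpetuity_uminus)
  have "neg.D n k \<omega> = - D n k \<omega>" for n k \<omega>
    by (simp add: neg.D_def D_def sum_negf)
  then show ?thesis
    using neg.max_D_negligible[OF c slow d] by (simp add: le_minus_iff)
qed

lemma prob_max_Ys:
  "prob {\<omega> \<in> space M. \<forall>k\<in>{1..n}. Ys k \<omega> \<le> t} = (1 - prob {\<omega> \<in> space M. t < Ys 0 \<omega>}) ^ n"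
proof (cases "n = 0")
  case False
  have le: "prob (Ys k -` {..t} \<inter> space M) = 1 - prob {\<omega> \<in> space M. t < Ys 0 \<omega>}" for k
  proof -
    have "prob (Ys k -` {..t} \<inter> space M) = prob {\<omega> \<in> space M. Ys 0 \<omega> \<in> {..t}}"
      using prob_Ys[of "{..t}" k] by (simp add: vimage_def Int_def conj_commute)
    also have "\<dots> = prob (space M - {\<omega> \<in> space M. t < Ys 0 \<omega>})"
      by (rule arg_cong[where f = prob]) auto
    also have "\<dots> = 1 - prob {\<omega> \<in> space M. t < Ys 0 \<omega>}"
      by (rule prob_compl) measurable
    finally show ?thesis .
  qed
  \<comment> \<open>For \<open>n = 0\<close> the empty intersection would be \<open>UNIV\<close>
    instead of \<open>space M\<close>.\<close>
  have "{\<omega> \<in> space M. \<forall>k\<in>{1..n}. Ys k \<omega> \<le> t} = (\<Inter>k\<in>{1..n}. Ys k -` {..t} \<inter> space M)"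
    using False by auto
  also have "prob \<dots> = (\<Prod>k\<in>{1..n}. prob (Ys k -` {..t} \<inter> space M))"
    using False by (intro indep_varsD_finite[OF indep_vars_subset[OF indep_Ys]]) auto
  finally show ?thesis by (simp add: le)
qed (simp add: prob_space)

text \<open>Outside events of vanishing probability every \<open>D n k\<close> is within
  \<open>d * c n\<close> of 0, so \<open>ln (perp_R Xs Ys n \<omega>)\<close> is squeezed by the
  maximum of the \<open>Ys k\<close>, whose law is an explicit \<open>n\<close>-th power.\<close>

lemma ln_perp_R_frechet_limit:
  assumes y: "y > 0" and c: "\<forall>\<^sub>F n in sequentially. 0 < c n"
    and slow: "(\<lambda>n. sqrt (real n) / c n) \<longlonglongrightarrow> 0"
    and tail: "\<And>z. z > 0 \<Longrightarrow> (\<lambda>n. real n * prob {\<omega> \<in> space M. z * c n < Ys 0 \<omega>}) \<longlonglongrightarrow> z powr \<alpha>"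
  shows "(\<lambda>n. prob {\<omega> \<in> space M. ln (perp_R Xs Ys n \<omega>) \<le> y * c n}) \<longlonglongrightarrow> frechet_cdf \<alpha> y"
proof -
  let ?F = "\<lambda>z. exp (- (z powr \<alpha>))"
  let ?m = "\<lambda>z n. prob {\<omega> \<in> space M. \<forall>k\<in>{1..n}. Ys k \<omega> \<le> z * c n}"
  let ?r = "\<lambda>n. prob {\<omega> \<in> space M. ln (perp_R Xs Ys n \<omega>) \<le> y * c n}"
  have m: "?m z \<longlonglongrightarrow> ?F z" if "z > 0" for z
    unfolding prob_max_Ys using tail[OF that] by (intro power_one_minus_tendsto_exp) auto
  have "?r \<longlonglongrightarrow> ?F y"
  proof (rule order_tendstoI)
    fix u assume u: "?F y < u"
    have "((\<lambda>d. ?F (y + d)) \<longlongrightarrow> ?F (y + 0)) (at_right 0)"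
      using y by (intro tendsto_intros) auto
    then have "\<forall>\<^sub>F d in at_right 0. ?F (y + d) < u"
      using u by (intro order_tendstoD(2)) auto
    then obtain d where d: "0 < d" "?F (y + d) < u"
      using eventually_at_right_0E[of _ 1] by auto
    \<comment> \<open>If no \<open>D n k\<close> falls to \<open>- (d * c n)\<close>, a small
      perpetuity forces every \<open>Ys k\<close> below \<open>(y + d) * c n\<close>.\<close>
    have "(\<lambda>n. ?m (y + d) n + prob {\<omega> \<in> space M. \<exists>k\<in>{1..n}. D n k \<omega> \<le> - (d * c n)}) \<longlonglongrightarrow> ?F (y + d) + 0"
      using d y by (intro tendsto_add m min_D_negligible c slow) auto
    then have "\<forall>\<^sub>F n in sequentially. ?m (y + d) n + prob {\<omega> \<in> space M. \<exists>k\<in>{1..n}. D n k \<omega> \<le> - (d * c n)} < u"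
      using d(2) by (intro order_tendstoD(2)) auto
    then show "\<forall>\<^sub>F n in sequentially. ?r n < u"
    proof eventually_elim
      case (elim n)
      have Y: "Ys k \<omega> \<le> (y + d) * c n"
        if "ln (perp_R Xs Ys n \<omega>) \<le> y * c n" "- (d * c n) < D n k \<omega>" "k \<in> {1..n}" for k \<omega>
        using ln_perp_R_ge[OF that(3), of \<omega>] that(1,2) by (simp add: distrib_right)
      have "?r n \<le> prob ({\<omega> \<in> space M. \<forall>k\<in>{1..n}. Ys k \<omega> \<le> (y + d) * c n} \<union> {\<omega> \<in> space M. \<exists>k\<in>{1..n}. D n k \<omega> \<le> - (d * c n)})"
      proof (rule finite_measure_mono)
        show "{\<omega> \<in> space M. ln (perp_R Xs Ys n \<omega>) \<le> y * c n}
          \<subseteq> {\<omega> \<in> space M. \<forall>k\<in>{1..n}. Ys k \<omega> \<le> (y + d) * c n} \<union> {\<omega> \<in> space M. \<exists>k\<in>{1..n}. D n k \<omega> \<le> - (d * c n)}"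
          using Y by (auto simp: not_le[symmetric] simp del: One_nat_def)
      qed measurable
      also have "\<dots> \<le> ?m (y + d) n + prob {\<omega> \<in> space M. \<exists>k\<in>{1..n}. D n k \<omega> \<le> - (d * c n)}"
        by (rule measure_Un_le) measurable
      finally show ?case using elim by linarith
    qed
  next
    fix l assume l: "l < ?F y"
    \<comment> \<open>One \<open>d\<close> covers the walk and one covers \<open>ln n\<close>;
      choosing \<open>d < y / 2\<close> keeps the threshold positive.\<close>
    have "((\<lambda>d. ?F (y - 2 * d)) \<longlongrightarrow> ?F (y - 2 * 0)) (at_right 0)"
      using y by (intro tendsto_intros) auto
    then have "\<forall>\<^sub>F d in at_right 0. l < ?F (y - 2 * d)"
      using l by (intro order_tendstoD(1)) auto
    then obtain d where d: "0 < d" "d < y / 2" "l < ?F (y - 2 * d)"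
      using eventually_at_right_0E[of _ "y / 2"] y by auto
    have "(\<lambda>n. ?m (y - 2 * d) n - prob {\<omega> \<in> space M. \<exists>k\<in>{1..n}. d * c n \<le> D n k \<omega>}) \<longlonglongrightarrow> ?F (y - 2 * d) - 0"
      using d y by (intro tendsto_diff m max_D_negligible c slow) auto
    then have lt: "\<forall>\<^sub>F n in sequentially. l < ?m (y - 2 * d) n - prob {\<omega> \<in> space M. \<exists>k\<in>{1..n}. d * c n \<le> D n k \<omega>}"
      using d(3) by (intro order_tendstoD(1)) auto
    have ln: "\<forall>\<^sub>F n in sequentially. ln (real n) \<le> d * c n"
    proof -
      have 1: "\<forall>\<^sub>F n in sequentially. sqrt (real n) / c n < d"
        using order_tendstoD(2)[OF slow d(1)] .
      have 2: "\<forall>\<^sub>F n in sequentially. ln (real n) \<le> sqrt (real n)" by real_asymp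
      show ?thesis using 1 2 c
        by eventually_elim (simp add: pos_divide_less_eq)
    qed
    show "\<forall>\<^sub>F n in sequentially. l < ?r n"
      using lt ln eventually_gt_at_top[of 0]
    proof eventually_elim
      case (elim n)
      have sub: "ln (perp_R Xs Ys n \<omega>) \<le> y * c n"
        if "\<forall>k\<in>{1..n}. D n k \<omega> < d * c n" "\<forall>k\<in>{1..n}. Ys k \<omega> \<le> (y - 2 * d) * c n" for \<omega>
      proof -
        have "Ys k \<omega> + D n k \<omega> \<le> (y - d) * c n" if "k \<in> {1..n}" for k
          using \<open>\<forall>k\<in>{1..n}. D n k \<omega> < _\<close> \<open>\<forall>k\<in>{1..n}. Ys k \<omega> \<le> _\<close> that
          by (force simp: algebra_simps)
        then have "ln (perp_R Xs Ys n \<omega>) \<le> ln (real n) + (y - d) * c n"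
          using elim by (intro ln_perp_R_le) auto
        also have "\<dots> \<le> y * c n" using elim by (simp add: algebra_simps)
        finally show ?thesis .
      qed
      have "?m (y - 2 * d) n \<le> prob ({\<omega> \<in> space M. ln (perp_R Xs Ys n \<omega>) \<le> y * c n} \<union> {\<omega> \<in> space M. \<exists>k\<in>{1..n}. d * c n \<le> D n k \<omega>})"
      proof (rule finite_measure_mono)
        show "{\<omega> \<in> space M. \<forall>k\<in>{1..n}. Ys k \<omega> \<le> (y - 2 * d) * c n}
          \<subseteq> {\<omega> \<in> space M. ln (perp_R Xs Ys n \<omega>) \<le> y * c n} \<union> {\<omega> \<in> space M. \<exists>k\<in>{1..n}. d * c n \<le> D n k \<omega>}"
          using sub by (auto simp: not_le[symmetric] simp del: One_nat_def)
      qed measurable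
      also have "\<dots> \<le> ?r n + prob {\<omega> \<in> space M. \<exists>k\<in>{1..n}. d * c n \<le> D n k \<omega>}"
        by (rule measure_Un_le) measurable
      finally show ?case using elim by linarith
    qed
  qed
  then show ?thesis using y by (simp add: frechet_cdf_def)
qed

section \<open>Convergence in distribution in the two regimes\<close>

lemma conv_distr_to_normal:
  assumes tail_Y: "((\<lambda>t. t\<^sup>2 * prob {\<omega> \<in> space M. t < Ys 0 \<omega>}) \<longlongrightarrow> 0) at_top"
  shows "conv_distr_to M (\<lambda>n \<omega>. perp_R Xs Ys n \<omega> powr (1 / (v * sqrt (real n)))) (exp_cdf abs_normal_cdf)"
proof (rule conv_distr_to_exp_cdf)
  have tail_X: "((\<lambda>t. t\<^sup>2 * prob {\<omega> \<in> space M. t < Xs 0 \<omega>}) \<longlongrightarrow> 0) at_top"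
    by (rule second_moment_tail[OF Xs_measurable square_integrable])
  show "(\<lambda>n. prob {\<omega> \<in> space M. ln (perp_R Xs Ys n \<omega>) \<le> y * (v * sqrt (real n))}) \<longlonglongrightarrow> abs_normal_cdf y"
    if "y > 0" for y
    by (rule ln_perp_R_normal_limit[OF that tail_X tail_Y])
  show "\<forall>\<^sub>F n in sequentially. 0 < v * sqrt (real n)"
    using eventually_gt_at_top[of 0] by eventually_elim (use v_pos in simp)
  have "((\<lambda>y. 2 * cdf std_normal_distribution y - 1) \<longlongrightarrow> 2 * cdf std_normal_distribution 0 - 1) (at_right 0)"
    by (intro tendsto_intros isCont_tendsto_compose[OF isCont_std_normal_cdf])
  moreover have "\<forall>\<^sub>F y in at_right 0. 2 * cdf std_normal_distribution y - 1 = abs_normal_cdf y"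
    using eventually_at_right_less[of 0] by eventually_elim (simp add: abs_normal_cdf_eq)
  ultimately show "(abs_normal_cdf \<longlongrightarrow> 0) (at_right 0)"
    by (simp add: std_normal_cdf_0 Lim_transform_eventually)
  \<comment> \<open>At \<open>y = 0\<close> the integral is over the degenerate interval
    \<open>{0..0}\<close>.\<close>
  show "abs_normal_cdf y = 0" if "y \<le> 0" for y
    using that by (cases "y = 0") (auto simp: abs_normal_cdf_def)
qed (simp_all add: perp_R_pos)

text \<open>Heaviness is a hypothesis here so that one statement covers both an index above -2,
  where it follows by doubling, and the index -2, where it is assumed.\<close>

lemma conv_distr_to_frechet:
  defines "h \<equiv> \<lambda>t. prob {\<omega> \<in> space M. t < Ys 0 \<omega>}"
  assumes rv: "regularly_varying h \<alpha>" and \<alpha>: "\<alpha> < 0"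
    and heavy: "filterlim (\<lambda>t. t\<^sup>2 * h t) at_top at_top"
  shows "conv_distr_to M (\<lambda>n \<omega>. perp_R Xs Ys n \<omega> powr (1 / Inf {t. h t \<le> 1 / real n})) (exp_cdf (frechet_cdf \<alpha>))"
proof -
  interpret L: real_distribution "distr M borel (Ys 0)" by simp
  have h: "h t = 1 - cdf (distr M borel (Ys 0)) t" for t
  proof -
    have "h t = prob (space M - {\<omega> \<in> space M. Ys 0 \<omega> \<le> t})"
      unfolding h_def by (rule arg_cong[where f = prob]) auto
    also have "\<dots> = 1 - prob {\<omega> \<in> space M. Ys 0 \<omega> \<le> t}" by (rule prob_compl) measurable
    finally show ?thesis by (simp add: cdf_def measure_distr vimage_def Int_def conj_commute)
  qed
  have mono: "antimono h"
    unfolding h by (rule antimonoI) (simp add: L.cdf_nondecreasing)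
  have top: "(h \<longlongrightarrow> 0) at_top"
    unfolding h using tendsto_diff[OF tendsto_const L.cdf_lim_at_top_prob, of 1] by simp
  have bot: "(h \<longlongrightarrow> 1) at_bot"
    unfolding h using tendsto_diff[OF tendsto_const L.cdf_lim_at_bot, of 1] by simp
  have nonneg: "0 \<le> h t" for t by (simp add: h_def)
  note quantile = quantile_tendsto[OF rv mono nonneg top bot heavy]
  show ?thesis
  proof (rule conv_distr_to_exp_cdf)
    show pos: "\<forall>\<^sub>F n in sequentially. 0 < Inf {t. h t \<le> 1 / real n}"
      using quantile(1) by (simp add: filterlim_at_top_dense)
    show "(\<lambda>n. prob {\<omega> \<in> space M. ln (perp_R Xs Ys n \<omega>) \<le> y * Inf {t. h t \<le> 1 / real n}}) \<longlonglongrightarrow> frechet_cdf \<alpha> y"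
      if "y > 0" for y
      using quantile(3) by (intro ln_perp_R_frechet_limit[OF that pos quantile(2)]) (simp add: h_def)
    have "((\<lambda>y. exp (- (y powr \<alpha>))) \<longlongrightarrow> 0) (at_right 0)"
      using \<alpha> by real_asymp
    moreover have "\<forall>\<^sub>F y in at_right 0. exp (- (y powr \<alpha>)) = frechet_cdf \<alpha> y"
      using eventually_at_right_less[of 0] by eventually_elim (simp add: frechet_cdf_def)
    ultimately show "(frechet_cdf \<alpha> \<longlongrightarrow> 0) (at_right 0)"
      by (rule Lim_transform_eventually)
  qed (simp_all add: perp_R_pos frechet_cdf_def)
qed

end

section \<open>Transfer to the generic pair and the three cases\<close>

theorem theorem3:
  fixes M :: "'a measure" and X Y :: "'a \<Rightarrow> real" and Xs Ys :: "nat \<Rightarrow> 'a \<Rightarrow> real" and v :: real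
  assumes "prob_space M"
    and "X \<in> borel_measurable M" and "Y \<in> borel_measurable M"
    and "\<And>k. (Xs k) \<in> borel_measurable M" and "\<And>k. (Ys k) \<in> borel_measurable M"
    and "prob_space.indep_vars M (\<lambda>_. borel \<Otimes>\<^sub>M borel) (\<lambda>k \<omega>. (Xs k \<omega>, Ys k \<omega>)) UNIV"
    and "\<And>k. distr M (borel \<Otimes>\<^sub>M borel) (\<lambda>\<omega>. (Xs k \<omega>, Ys k \<omega>))
              = distr M (borel \<Otimes>\<^sub>M borel) (\<lambda>\<omega>. (X \<omega>, Y \<omega>))"
    and "integrable M X" and "prob_space.expectation M X = 0"
    and "integrable M (\<lambda>\<omega>. (X \<omega>)\<^sup>2)"
    and "v > 0" and "prob_space.variance M X = v\<^sup>2"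
  defines "h \<equiv> (\<lambda>t. measure M {\<omega> \<in> space M. Y \<omega> > t})"
    and "\<gamma> \<equiv> (\<lambda>n::nat. Inf {t. measure M {\<omega> \<in> space M. Y \<omega> > t} \<le> 1 / real n})"
    and "R \<equiv> perp_R Xs Ys"
  shows
    "(integrable M (\<lambda>\<omega>. (Y \<omega>)\<^sup>2) \<longrightarrow>
        conv_distr_to M (\<lambda>n \<omega>. R n \<omega> powr (1 / (v * sqrt (real n)))) (exp_cdf abs_normal_cdf))
   \<and> (\<forall>\<alpha>. -2 < \<alpha> \<and> \<alpha> < 0 \<and> regularly_varying h \<alpha> \<longrightarrow>
        conv_distr_to M (\<lambda>n \<omega>. R n \<omega> powr (1 / \<gamma> n)) (exp_cdf (frechet_cdf \<alpha>)))
   \<and> (regularly_varying h (-2) \<longrightarrow>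
        (filterlim (\<lambda>t. t\<^sup>2 * h t) at_top at_top \<longrightarrow>
          conv_distr_to M (\<lambda>n \<omega>. R n \<omega> powr (1 / \<gamma> n)) (exp_cdf (frechet_cdf (-2))))
      \<and> (((\<lambda>t. t\<^sup>2 * h t) \<longlongrightarrow> 0) at_top \<longrightarrow>
          conv_distr_to M (\<lambda>n \<omega>. R n \<omega> powr (1 / (v * sqrt (real n)))) (exp_cdf abs_normal_cdf)))"
proof -
  interpret prob_space M by fact
  note [measurable] = assms(2-5)
  \<comment> \<open>Projecting the common law of the pairs identifies index 0 with
    \<open>(X, Y)\<close>, which carries the moment and tail assumptions into the locale.\<close>
  have distr_X: "distr M borel (Xs 0) = distr M borel X"
    using arg_cong[OF assms(7)[of 0], of "\<lambda>N. distr N borel fst"] by (simp add: distr_distr comp_def)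
  have distr_Y: "distr M borel (Ys 0) = distr M borel Y"
    using arg_cong[OF assms(7)[of 0], of "\<lambda>N. distr N borel snd"] by (simp add: distr_distr comp_def)
  have X: "expectation (\<lambda>\<omega>. f (Xs 0 \<omega>)) = expectation (\<lambda>\<omega>. f (X \<omega>))"
      "integrable M (\<lambda>\<omega>. f (Xs 0 \<omega>)) \<longleftrightarrow> integrable M (\<lambda>\<omega>. f (X \<omega>))"
    if [measurable]: "f \<in> borel_measurable borel" for f :: "real \<Rightarrow> real"
    using integral_distr[of "Xs 0" M borel f] integral_distr[of X M borel f]
      integrable_distr_eq[of "Xs 0" M borel f] integrable_distr_eq[of X M borel f] distr_X
    by auto
  interpret perpetuity M Xs Ys v
  proof
    show "expectation (Xs 0) = 0" using X(1)[of "\<lambda>x. x"] assms(9) by simp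
    then show "variance (Xs 0) = v\<^sup>2" using X(1)[of "\<lambda>x. x\<^sup>2"] assms(9,12) by simp
    show "integrable M (\<lambda>\<omega>. (Xs 0 \<omega>)\<^sup>2)" using X(2)[of "\<lambda>x. x\<^sup>2"] assms(10) by simp
    show "distr M (borel \<Otimes>\<^sub>M borel) (\<lambda>\<omega>. (Xs k \<omega>, Ys k \<omega>)) = distr M (borel \<Otimes>\<^sub>M borel) (\<lambda>\<omega>. (Xs 0 \<omega>, Ys 0 \<omega>))" for k
      by (simp only: assms(7))
  qed (use assms in auto)
  have tail: "prob {\<omega> \<in> space M. t < Ys 0 \<omega>} = h t" for t
    using arg_cong[OF distr_Y, of "\<lambda>N. measure N {t<..}"]
    by (simp add: h_def measure_distr vimage_def Int_def conj_commute)
  have \<gamma>: "\<gamma> = (\<lambda>n. Inf {t. h t \<le> 1 / real n})" by (simp add: \<gamma>_def h_def)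
  have h: "antimono h" "\<And>t. 0 \<le> h t"
    unfolding h_def by (auto intro!: antimonoI finite_measure_mono)
  have moment: "((\<lambda>t. t\<^sup>2 * h t) \<longlongrightarrow> 0) at_top" if "integrable M (\<lambda>\<omega>. (Y \<omega>)\<^sup>2)"
    using second_moment_tail[OF _ that] by (simp add: h_def)
  \<comment> \<open>Used for indices above -2 with heaviness from the doubling lemma, and for -2
    with heaviness given: there \<open>t\<^sup>2 * h t\<close> is the slowly varying factor. The
    normal limit likewise serves twice, through \<open>moment\<close> and through the vanishing of
    that factor.\<close>
  note frechet = conv_distr_to_frechet[unfolded tail, folded R_def]
  show ?thesis
    using conv_distr_to_normal[unfolded tail, folded R_def] moment frechet regularly_varying_square_mult_at_top[OF _ _ h]
    by (auto simp: \<gamma>)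
qed

end
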